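(* Let $(X,d,A)$ be a metric pair with $A\neq\emptyset$ and $(X,d)$ complete, separable and boundedly compact. Then $\mathcal{M}_1(X,A)$ is a normed vector space with norm given by $\|\mu\|_{\mathrm{KR}}=W_1(\mu^+,\mu^-)$ for $\mu\in\mathcal{M}_1(X,A)$.
   Context: A metric pair $(X,d,A)$ is a metric space $(X,d)$ with a closed subset $A\subset X$; $d_A(x)=\inf_{a\in A}d(x,a)$. $X$ is boundedly compact if every closed bounded subset is compact. Measures take values in $[0,\infty]$. Let $\mathcal{B}^+(X)$ be the commutative monoid of Borel measures on $X$ and $\mathcal{B}^+(X,A)=\mathcal{B}^+(X)/\mathcal{B}^+(A)$ the quotient monoid: $\mu\sim\nu$ iff $\mu+\sigma=\nu+\tau$ for some Borel measures $\sigma,\tau$ concentrated on $A$; equivalently $\mu,\nu$ agree on Borel subsets of $X\setminus A$, so relative Borel measures correspond bijectively to Borel measures on $X\setminus A$. Integrals of functions vanishing on $A$ are well defined. $\mu$ is tight if $\mu(E)=\sup\{\mu(K): K\subset E \text{ compact}\}$ for every Borel $E\subset X\setminus A$. $\mathcal{M}_1^+(X,A)$ is the set of tight $\mu\in\mathcal{B}^+(X,A)$ with $\int d_A\,d\mu<\infty$; it is a cancellative commutative monoid with an $\mathbb{R}^+$-action. $\mathcal{M}_1(X,A)$ is its Grothendieck group (formal differences $\mu-\nu$, with $\mu-\nu=\mu'-\nu'$ iff $\mu+\nu'=\mu'+\nu$), a real vector space and a Riesz space (vector lattice) with positive cone $\mathcal{M}_1^+(X,A)$; each $\mu\in\mathcal{M}_1(X,A)$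 is uniquely $\mu=\mu^+-\mu^-$ with $\mu^\pm\in\mathcal{M}_1^+(X,A)$ and $\mu^+\wedge\mu^-=0$. The product pair is $(X\times X,d+d,A\times A)$, with $\mathcal{B}^+(X^2,A^2)$ defined in the same way. $\Pi(\mu,\nu)$ is the set of $\pi\in\mathcal{B}^+(X^2,A^2)$ whose pushforwards under the two projections $X^2\to X$ are $\mu$ and $\nu$ in $\mathcal{B}^+(X,A)$. With $\bar d(x,y)=\min(d(x,y),d_A(x)+d_A(y))$, $W_1(\mu,\nu)=\inf_{\pi\in\Pi(\mu,\nu)}\int_{X\times X}\bar d\,d\pi$. The norm $\|\cdot\|_{\mathrm{KR}}$ is called the relative Kantorovich-Rubinstein norm. *)

theory Defs
  imports "HOL-Analysis.Analysis" "HOL-Algebra.Module" "HOL-Algebra.Algebraic_Closure_Type"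
begin

section \<open>Relative Borel measures\<close>

definition borel_measures :: "'a::topological_space measure set" where
  "borel_measures = {\<mu>. sets \<mu> = sets borel}"

definition sum_measure :: "'a measure \<Rightarrow> 'a measure \<Rightarrow> 'a measure" where
  "sum_measure \<mu> \<nu> = measure_of (space \<mu>) (sets \<mu>) (\<lambda>E. emeasure \<mu> E + emeasure \<nu> E)"

text \<open>Borel measures on the closed subset \<open>A\<close> are identified with the Borel measures on the whole
  space that are concentrated on \<open>A\<close>.\<close>

definition rel_eq :: "'a::topological_space set \<Rightarrow> ('a measure \<times> 'a measure) set" where
  "rel_eq A = {(\<mu>, \<nu>). \<mu> \<in> borel_measures \<and> \<nu> \<in> borel_measures \<and>
     (\<exists>\<sigma>\<in>borel_measures. \<exists>\<tau>\<in>borel_measures. emeasure \<sigma> (- A) = 0 \<and> emeasure \<tau> (- A) = 0 \<and>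
        sum_measure \<mu> \<sigma> = sum_measure \<nu> \<tau>)}"

definition rel_measures :: "'a::topological_space set \<Rightarrow> 'a measure set set" where
  "rel_measures A = borel_measures // rel_eq A"

definition rel_zero :: "'a::topological_space set \<Rightarrow> 'a measure set" where
  "rel_zero A = rel_eq A `` {null_measure borel}"

definition rel_add ::
    "'a::topological_space set \<Rightarrow> 'a measure set \<Rightarrow> 'a measure set \<Rightarrow> 'a measure set" where
  "rel_add A m n = (\<Union>\<mu>\<in>m. \<Union>\<nu>\<in>n. rel_eq A `` {sum_measure \<mu> \<nu>})"

definition rel_scale :: "'a::topological_space set \<Rightarrow> real \<Rightarrow> 'a measure set \<Rightarrow> 'a measure set" where
  "rel_scale A c m = (\<Union>\<mu>\<in>m. rel_eq A `` {scale_measure (ennreal c) \<mu>})"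

text \<open>Pushforward along a map of pairs into a pair with distinguished subset \<open>B\<close>.\<close>

definition rel_distr ::
    "'b::topological_space set \<Rightarrow> ('a \<Rightarrow> 'b) \<Rightarrow> 'a measure set \<Rightarrow> 'b measure set" where
  "rel_distr B f m = (\<Union>\<mu>\<in>m. rel_eq B `` {distr \<mu> borel f})"

text \<open>The next two are meaningful only when the value does not depend on the representative, i.e.
  for \<open>E\<close> disjoint from \<open>A\<close> and for \<open>f\<close> vanishing on \<open>A\<close>, respectively.\<close>

definition rel_emeasure :: "'a measure set \<Rightarrow> 'a set \<Rightarrow> ennreal" where
  "rel_emeasure m E = the_elem ((\<lambda>\<mu>. emeasure \<mu> E) ` m)"

definition rel_nn_integral :: "'a measure set \<Rightarrow> ('a \<Rightarrow> ennreal) \<Rightarrow> ennreal" where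
  "rel_nn_integral m f = the_elem ((\<lambda>\<mu>. \<integral>\<^sup>+x. f x \<partial>\<mu>) ` m)"

definition rel_tight :: "'a::topological_space set \<Rightarrow> 'a measure set \<Rightarrow> bool" where
  "rel_tight A m \<longleftrightarrow> (\<forall>E\<in>sets borel. E \<subseteq> - A \<longrightarrow>
     rel_emeasure m E = (SUP K\<in>{K. compact K \<and> K \<subseteq> E}. rel_emeasure m K))"

section \<open>The space of relative signed measures of finite first moment\<close>

definition M1_plus :: "'a::metric_space set \<Rightarrow> 'a measure set set" where
  "M1_plus A = {m \<in> rel_measures A. rel_tight A m \<and>
     rel_nn_integral m (\<lambda>x. ennreal (infdist x A)) < \<infinity>}"

definition groth_eq :: "'a::metric_space set \<Rightarrow>
    (('a measure set \<times> 'a measure set) \<times> ('a measure set \<times> 'a measure set)) set" where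
  "groth_eq A = {((m, n), (m', n')). m \<in> M1_plus A \<and> n \<in> M1_plus A \<and>
     m' \<in> M1_plus A \<and> n' \<in> M1_plus A \<and> rel_add A m n' = rel_add A m' n}"

text \<open>The formal difference of \<open>m\<close> and \<open>n\<close>.\<close>

definition formal_diff :: "'a::metric_space set \<Rightarrow> 'a measure set \<Rightarrow> 'a measure set \<Rightarrow>
    ('a measure set \<times> 'a measure set) set" where
  "formal_diff A m n = groth_eq A `` {(m, n)}"

text \<open>The multiplicative structure of the record is irrelevant for a module.\<close>

definition M1 :: "'a::metric_space set \<Rightarrow> (real, ('a measure set \<times> 'a measure set) set) module" where
  "M1 A = \<lparr> carrier = (M1_plus A \<times> M1_plus A) // groth_eq A,
     mult = undefined, one = undefined,
     zero = formal_diff A (rel_zero A) (rel_zero A),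
     add = (\<lambda>x y. \<Union>(m, n)\<in>x. \<Union>(m', n')\<in>y. formal_diff A (rel_add A m m') (rel_add A n n')),
     smult = (\<lambda>c x. \<Union>(m, n)\<in>x.
        if 0 \<le> c then formal_diff A (rel_scale A c m) (rel_scale A c n)
        else formal_diff A (rel_scale A (- c) n) (rel_scale A (- c) m)) \<rparr>"

definition M1_embed :: "'a::metric_space set \<Rightarrow> 'a measure set \<Rightarrow> ('a measure set \<times> 'a measure set) set" where
  "M1_embed A m = formal_diff A m (rel_zero A)"

text \<open>The Riesz space order, with positive cone \<open>M1_plus\<close>.\<close>

definition M1_order :: "'a::metric_space set \<Rightarrow> ('a measure set \<times> 'a measure set) set gorder" where
  "M1_order A = \<lparr> carrier = carrier (M1 A), eq = (=),
     le = (\<lambda>x y. \<exists>p\<in>M1_plus A. y = x \<oplus>\<^bsub>M1 A\<^esub> M1_embed A p) \<rparr>"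

text \<open>\<open>(p, n)\<close> is the pair of positive and negative parts of \<open>x\<close>: \<open>x = p - n\<close>, and the infimum of
  \<open>p\<close> and \<open>n\<close> exists and equals 0.\<close>

definition is_parts :: "'a::metric_space set \<Rightarrow> ('a measure set \<times> 'a measure set) set \<Rightarrow>
    'a measure set \<times> 'a measure set \<Rightarrow> bool" where
  "is_parts A x = (\<lambda>(p, n). p \<in> M1_plus A \<and> n \<in> M1_plus A \<and> x = formal_diff A p n \<and>
     greatest (M1_order A) \<zero>\<^bsub>M1 A\<^esub> (Lower (M1_order A) {M1_embed A p, M1_embed A n}))"

definition pos_part :: "'a::metric_space set \<Rightarrow> ('a measure set \<times> 'a measure set) set \<Rightarrow> 'a measure set" where
  "pos_part A x = fst (THE pn. is_parts A x pn)"

definition neg_part :: "'a::metric_space set \<Rightarrow> ('a measure set \<times> 'a measure set) set \<Rightarrow> 'a measure set" where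
  "neg_part A x = snd (THE pn. is_parts A x pn)"

section \<open>The Wasserstein distance and the relative Kantorovich-Rubinstein norm\<close>

text \<open>Relative measures on the product pair involve only the Borel sets of the product, and the metric
  \<open>d + d\<close> induces the product topology, so the library's product topology is used.\<close>

definition couplings :: "'a::metric_space set \<Rightarrow> 'a measure set \<Rightarrow> 'a measure set \<Rightarrow>
    ('a \<times> 'a) measure set set" where
  "couplings A m n = {\<pi> \<in> rel_measures (A \<times> A). rel_distr A fst \<pi> = m \<and> rel_distr A snd \<pi> = n}"

definition dbar :: "'a::metric_space set \<Rightarrow> 'a \<Rightarrow> 'a \<Rightarrow> real" where
  "dbar A x y = min (dist x y) (infdist x A + infdist y A)"

definition W1 :: "'a::metric_space set \<Rightarrow> 'a measure set \<Rightarrow> 'a measure set \<Rightarrow> ennreal" where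
  "W1 A m n = (INF \<pi>\<in>couplings A m n. rel_nn_integral \<pi> (\<lambda>(x, y). ennreal (dbar A x y)))"

definition KR_norm :: "'a::metric_space set \<Rightarrow> ('a measure set \<times> 'a measure set) set \<Rightarrow> ennreal" where
  "KR_norm A x = W1 A (pos_part A x) (neg_part A x)"

section \<open>Normed real vector spaces with explicit carrier\<close>

abbreviation real_field :: "real ring" where
  "real_field \<equiv> ring_of_type_algebra"

locale normed_real_space = module real_field V
  for V :: "(real, 'v) module" (structure) +
  fixes nrm :: "'v \<Rightarrow> real"
  assumes nrm_nonneg: "x \<in> carrier V \<Longrightarrow> 0 \<le> nrm x"
    and nrm_eq_zero_iff: "x \<in> carrier V \<Longrightarrow> nrm x = 0 \<longleftrightarrow> x = \<zero>\<^bsub>V\<^esub>"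
    and nrm_smult: "x \<in> carrier V \<Longrightarrow> nrm (c \<odot>\<^bsub>V\<^esub> x) = \<bar>c\<bar> * nrm x"
    and nrm_triangle: "x \<in> carrier V \<Longrightarrow> y \<in> carrier V \<Longrightarrow> nrm (x \<oplus>\<^bsub>V\<^esub> y) \<le> nrm x + nrm y"

end

theory Submission
  imports Defs
begin

text \<open>A relative measure of finite first moment is determined by the finite measure with density
  \<open>d\<^sub>A\<close>, and the vector space structure is read off these weights. Tightness is automatic, because the
  space is Polish. The Jordan decomposition of a difference of weights gives the positive and negative
  parts.

  The cost \<open>W\<close> of transport is subadditive, and it satisfies the triangle inequality: plans are glued
  approximately, along a countable partition of the complement of \<open>A\<close> into cells whose diameter is
  small compared with \<open>d\<^sub>A\<close>. Both facts give the cancellation law \<open>W (\<mu> + \<rho>) (\<nu> + \<rho>) = W \<mu> \<nu>\<close>, so the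
  norm of \<open>\<mu> - \<nu>\<close> is \<open>W \<mu> \<nu>\<close> for any representatives, and the norm axioms follow. Definiteness holds
  since Lipschitz functions vanishing on \<open>A\<close> separate the measures.\<close>

section \<open>Relative classes of Borel measures\<close>

lemma space_sum_measure [simp]: "space (sum_measure M N) = space M"
  by (simp add: sum_measure_def space_measure_of_conv)

lemma sets_sum_measure [simp, measurable_cong]: "sets (sum_measure M N) = sets M"
  by (simp add: sum_measure_def)

lemma emeasure_sum_measure:
  assumes "sets N = sets M" and "E \<in> sets M"
  shows "emeasure (sum_measure M N) E = emeasure M E + emeasure N E"
  unfolding sum_measure_def
proof (rule emeasure_measure_of_sigma)
  show "sigma_algebra (space M) (sets M)" ..
  show "positive (sets M) (\<lambda>E. emeasure M E + emeasure N E)"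
    by (simp add: positive_def)
  show "countably_additive (sets M) (\<lambda>E. emeasure M E + emeasure N E)"
  proof (rule countably_additiveI)
    fix F :: "nat \<Rightarrow> 'a set"
    assume F: "range F \<subseteq> sets M" "disjoint_family F" "(\<Union>i. F i) \<in> sets M"
    have "(\<Sum>i. emeasure M (F i) + emeasure N (F i)) = (\<Sum>i. emeasure M (F i)) + (\<Sum>i. emeasure N (F i))"
      by (rule suminf_add[symmetric]) auto
    also have "\<dots> = emeasure M (\<Union>i. F i) + emeasure N (\<Union>i. F i)"
      using F assms by (simp add: suminf_emeasure)
    finally show "(\<Sum>i. emeasure M (F i) + emeasure N (F i)) = emeasure M (\<Union>i. F i) + emeasure N (\<Union>i. F i)" .
  qed
qed fact

lemma nn_integral_sum_measure:
  assumes N: "sets N = sets M" and f: "f \<in> borel_measurable M"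
  shows "(\<integral>\<^sup>+x. f x \<partial>sum_measure M N) = (\<integral>\<^sup>+x. f x \<partial>M) + (\<integral>\<^sup>+x. f x \<partial>N)"
  using f
proof (induct rule: borel_measurable_induct)
  have [measurable_cong]: "sets N = sets M" by fact
  have spN: "space N = space M" using N by (rule sets_eq_imp_space_eq)
  case (cong f g)
  have "integral\<^sup>N L f = integral\<^sup>N L g" if "space L = space M" for L
    using cong(3) that by (intro nn_integral_cong) simp
  from this[of M] this[of N] this[of "sum_measure M N"] show ?case
    using cong(4) spN by simp
next
  case (set E)
  then show ?case using N by (simp add: emeasure_sum_measure)
next
  have [measurable_cong]: "sets N = sets M" by fact
  case (mult u c)
  note [measurable] = mult(2)
  show ?case using mult by (simp add: nn_integral_cmult distrib_left)
next
  have [measurable_cong]: "sets N = sets M" by fact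
  case (add u v)
  note [measurable] = add(1,4)
  show ?case using add by (simp add: nn_integral_add add_ac)
next
  have [measurable_cong]: "sets N = sets M" by fact
  case (seq U)
  note [measurable] = seq(1)
  have conv: "(\<integral>\<^sup>+x. (SUP i. U i x) \<partial>L) = (SUP i. \<integral>\<^sup>+x. U i x \<partial>L)"
    if "\<And>i. U i \<in> borel_measurable L" for L :: "'a measure"
    by (rule nn_integral_monotone_convergence_SUP) (use seq that in auto)
  have inc: "incseq (\<lambda>i. \<integral>\<^sup>+x. U i x \<partial>L)" for L :: "'a measure"
    using seq(4) by (auto simp: incseq_def le_fun_def intro!: nn_integral_mono)
  have "(\<integral>\<^sup>+x. (SUP i. U i x) \<partial>sum_measure M N) = (SUP i. (\<integral>\<^sup>+x. U i x \<partial>M) + (\<integral>\<^sup>+x. U i x \<partial>N))"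
    by (subst conv) (simp_all add: seq(3))
  also have "\<dots> = (SUP i. \<integral>\<^sup>+x. U i x \<partial>M) + (SUP i. \<integral>\<^sup>+x. U i x \<partial>N)"
    by (rule ennreal_SUP_add[OF inc inc])
  finally show ?case by (simp add: conv image_comp)
qed

lemma borel_measures_iff: "M \<in> borel_measures \<longleftrightarrow> sets M = sets borel"
  by (simp add: borel_measures_def)

lemma rel_eq_iff:
  fixes B :: "'b::topological_space set"
  assumes B: "closed B" and M: "sets M = sets borel" and N: "sets N = sets borel"
  shows "(M, N) \<in> rel_eq B \<longleftrightarrow> (\<forall>E\<in>sets borel. E \<subseteq> - B \<longrightarrow> emeasure M E = emeasure N E)"
proof
  assume "(M, N) \<in> rel_eq B"
  then obtain S T where S: "sets S = sets borel" "emeasure S (- B) = 0"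
    and T: "sets T = sets borel" "emeasure T (- B) = 0"
    and eq: "sum_measure M S = sum_measure N T"
    by (auto simp: rel_eq_def borel_measures_iff)
  show "\<forall>E\<in>sets borel. E \<subseteq> - B \<longrightarrow> emeasure M E = emeasure N E"
  proof (intro ballI impI)
    fix E assume E: "E \<in> sets (borel :: 'b measure)" "E \<subseteq> - B"
    have "- B \<in> sets (borel :: 'b measure)" using B by auto
    then have "emeasure S E = 0" "emeasure T E = 0"
      using emeasure_eq_0 S T E by metis+
    then show "emeasure M E = emeasure N E"
      using arg_cong[OF eq, of "\<lambda>L. emeasure L E"] E M N S T by (simp add: emeasure_sum_measure)
  qed
next
  assume eq: "\<forall>E\<in>sets borel. E \<subseteq> - B \<longrightarrow> emeasure M E = emeasure N E"
  have [measurable]: "B \<in> sets (borel :: 'b measure)" using B by auto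
  have [measurable_cong]: "sets M = sets borel" "sets N = sets borel" by fact+
  define S where "S = density N (indicator B)"
  define T where "T = density M (indicator B)"
  have sets: "sets S = sets borel" "sets T = sets borel"
    by (simp_all add: S_def T_def M N)
  have S: "emeasure S E = emeasure N (B \<inter> E)" if "E \<in> sets borel" for E
    using that N unfolding S_def
    by (subst emeasure_density) (auto simp: indicator_inter_arith[symmetric])
  have T: "emeasure T E = emeasure M (B \<inter> E)" if "E \<in> sets borel" for E
    using that M unfolding T_def
    by (subst emeasure_density) (auto simp: indicator_inter_arith[symmetric])
  have split: "emeasure L E = emeasure L (E - B) + emeasure L (B \<inter> E)"
    if "E \<in> sets borel" "sets L = sets borel" for E and L :: "'b measure"
    using that by (subst plus_emeasure) (auto intro!: arg_cong[where f="emeasure L"])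
  have "sum_measure M S = sum_measure N T"
  proof (rule measure_eqI)
    fix E assume "E \<in> sets (sum_measure M S)"
    then have E: "E \<in> sets borel" using M by simp
    have "E - B \<in> sets borel" using E by measurable
    then have "emeasure M (E - B) = emeasure N (E - B)" using eq by blast
    then show "emeasure (sum_measure M S) E = emeasure (sum_measure N T) E"
      using E M N sets split[of E M] split[of E N] S[of E] T[of E]
      by (simp add: emeasure_sum_measure add_ac)
  qed (simp add: M N)
  moreover have "emeasure S (- B) = 0" "emeasure T (- B) = 0"
    by (simp_all add: S T)
  ultimately show "(M, N) \<in> rel_eq B"
    using sets M N unfolding rel_eq_def borel_measures_iff Bex_def by blast
qed

lemma equiv_rel_eq:
  assumes "closed B" shows "equiv borel_measures (rel_eq B)"
proof (rule equivI)
  show "rel_eq B \<subseteq> borel_measures \<times> borel_measures" by (auto simp: rel_eq_def)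
  show "refl_on borel_measures (rel_eq B)"
    using assms by (auto simp: refl_on_def borel_measures_iff rel_eq_iff)
  show "sym (rel_eq B)"
    by (auto simp: sym_def rel_eq_def intro: sym)
  have "(L, N) \<in> rel_eq B" if "(L, M) \<in> rel_eq B" "(M, N) \<in> rel_eq B" for L M N
  proof -
    have "sets L = sets borel" "sets M = sets borel" "sets N = sets borel"
      using that by (auto simp: rel_eq_def borel_measures_iff)
    with that show ?thesis by (simp add: rel_eq_iff assms)
  qed
  then show "trans (rel_eq B)" by (auto simp: trans_def)
qed

definition rel_class :: "'b::topological_space set \<Rightarrow> 'b measure \<Rightarrow> 'b measure set" where
  "rel_class B M = rel_eq B `` {M}"

lemma rel_class_self:
  assumes "closed B" "sets M = sets borel" shows "M \<in> rel_class B M"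
  using assms by (simp add: rel_class_def rel_eq_iff)

lemma rel_class_mem:
  assumes "M' \<in> rel_class B M" shows "sets M' = sets borel" "sets M = sets borel" "(M, M') \<in> rel_eq B"
  using assms by (auto simp: rel_class_def rel_eq_def borel_measures_iff)

lemma rel_class_eq_iff:
  assumes "closed B" "sets M = sets borel" "sets N = sets borel"
  shows "rel_class B M = rel_class B N \<longleftrightarrow> (\<forall>E\<in>sets borel. E \<subseteq> - B \<longrightarrow> emeasure M E = emeasure N E)"
  unfolding rel_class_def
  using eq_equiv_class_iff[OF equiv_rel_eq[OF assms(1)], of M N] rel_eq_iff[OF assms] assms
  by (simp add: borel_measures_iff)

lemma rel_measures_eq: "rel_measures B = rel_class B ` {M. sets M = sets borel}"
  by (auto simp: rel_measures_def quotient_def rel_class_def borel_measures_def)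

lemma UN_rel_class:
  assumes "closed B" "sets M = sets borel"
    and "\<And>M'. M' \<in> rel_class B M \<Longrightarrow> F M' = F M"
  shows "(\<Union>M'\<in>rel_class B M. F M') = F M"
  using assms(3) rel_class_self[OF assms(1,2)] by blast

lemma rel_emeasure_class:
  assumes "closed B" "sets M = sets borel" "E \<in> sets borel" "E \<subseteq> - B"
  shows "rel_emeasure (rel_class B M) E = emeasure M E"
proof -
  have "emeasure M' E = emeasure M E" if "M' \<in> rel_class B M" for M'
    using rel_class_mem[OF that] assms by (simp add: rel_eq_iff)
  then have "(\<lambda>M'. emeasure M' E) ` rel_class B M = {emeasure M E}"
    using rel_class_self[OF assms(1,2)] by blast
  then show ?thesis by (simp add: rel_emeasure_def)
qed

lemma nn_integral_rel_eq:
  fixes B :: "'b::topological_space set"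
  assumes B: "closed B" and eq: "(M, N) \<in> rel_eq B"
    and f: "f \<in> borel_measurable borel" and f0: "\<And>x. x \<in> B \<Longrightarrow> f x = 0"
  shows "(\<integral>\<^sup>+x. f x \<partial>M) = (\<integral>\<^sup>+x. f x \<partial>N)"
proof -
  have [measurable]: "B \<in> sets (borel :: 'b measure)" using B by auto
  note [measurable] = f
  have sets: "sets M = sets borel" "sets N = sets borel"
    using eq by (auto simp: rel_eq_def borel_measures_iff)
  note [measurable_cong] = sets
  have restrict: "emeasure (density L (indicator (- B))) E = emeasure L (- B \<inter> E)"
    if "E \<in> sets borel" "sets L = sets borel" for E and L :: "'b measure"
  proof -
    note [measurable_cong] = that(2)
    have "- B \<inter> E \<in> sets L" using that by auto
    then show ?thesis using that
      by (subst emeasure_density) (auto simp: indicator_inter_arith[symmetric])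
  qed
  have "density M (indicator (- B)) = density N (indicator (- B))"
  proof (rule measure_eqI)
    fix E assume "E \<in> sets (density M (indicator (- B)))"
    then have E: "E \<in> sets borel" using sets by simp
    then have "- B \<inter> E \<in> sets borel" by measurable
    then have "emeasure M (- B \<inter> E) = emeasure N (- B \<inter> E)"
      using eq B sets by (simp add: rel_eq_iff)
    then show "emeasure (density M (indicator (- B))) E = emeasure (density N (indicator (- B))) E"
      using E sets by (simp add: restrict)
  qed (simp add: sets)
  moreover have "(\<integral>\<^sup>+x. f x \<partial>L) = (\<integral>\<^sup>+x. f x \<partial>density L (indicator (- B)))"
    if "sets L = sets borel" for L :: "'b measure"
  proof -
    note [measurable_cong] = that
    show ?thesis
      by (subst nn_integral_density) (auto intro!: nn_integral_cong simp: f0 split: split_indicator)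
  qed
  ultimately show ?thesis using sets by metis
qed

lemma rel_nn_integral_class:
  assumes "closed B" "sets M = sets borel" "f \<in> borel_measurable borel" "\<And>x. x \<in> B \<Longrightarrow> f x = 0"
  shows "rel_nn_integral (rel_class B M) f = (\<integral>\<^sup>+x. f x \<partial>M)"
proof -
  have "(\<integral>\<^sup>+x. f x \<partial>M') = (\<integral>\<^sup>+x. f x \<partial>M)" if "M' \<in> rel_class B M" for M'
    using nn_integral_rel_eq[OF assms(1) rel_class_mem(3)[OF that] assms(3,4)] by simp
  then have "(\<lambda>M'. \<integral>\<^sup>+x. f x \<partial>M') ` rel_class B M = {\<integral>\<^sup>+x. f x \<partial>M}"
    using rel_class_self[OF assms(1,2)] by blast
  then show ?thesis by (simp add: rel_nn_integral_def)
qed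

lemma rel_zero_class: "rel_zero B = rel_class B (null_measure borel)"
  by (simp add: rel_zero_def rel_class_def)

lemma rel_add_class:
  assumes "closed B" "sets M = sets borel" "sets N = sets borel"
  shows "rel_add B (rel_class B M) (rel_class B N) = rel_class B (sum_measure M N)"
proof -
  have "rel_class B (sum_measure M' N') = rel_class B (sum_measure M N)"
    if "M' \<in> rel_class B M" "N' \<in> rel_class B N" for M' N'
    using rel_class_mem[OF that(1)] rel_class_mem[OF that(2)] assms
    by (simp add: rel_class_eq_iff rel_eq_iff emeasure_sum_measure)
  then show ?thesis
    using rel_class_self[OF assms(1,2)] rel_class_self[OF assms(1,3)]
    unfolding rel_add_def rel_class_def[symmetric] by fast
qed

lemma rel_scale_class:
  assumes "closed B" "sets M = sets borel"
  shows "rel_scale B c (rel_class B M) = rel_class B (scale_measure (ennreal c) M)"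
  unfolding rel_scale_def rel_class_def[symmetric]
proof (rule UN_rel_class[OF assms])
  fix M' assume M': "M' \<in> rel_class B M"
  show "rel_class B (scale_measure (ennreal c) M') = rel_class B (scale_measure (ennreal c) M)"
    using rel_class_mem[OF M'] assms by (simp add: rel_class_eq_iff rel_eq_iff)
qed

lemma rel_distr_class:
  fixes B :: "'b::topological_space set" and C :: "'c::topological_space set"
  assumes B: "closed B" and C: "closed C" and M: "sets M = sets borel"
    and f: "f \<in> borel_measurable borel" and fB: "f ` B \<subseteq> C"
  shows "rel_distr C f (rel_class B M) = rel_class C (distr M borel f)"
  unfolding rel_distr_def rel_class_def[symmetric]
proof (rule UN_rel_class[OF B M])
  fix M' assume M': "M' \<in> rel_class B M"
  note sets = rel_class_mem(1,2)[OF M']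
  have fm: "f \<in> borel_measurable L" if "sets L = sets borel" for L
    using f unfolding measurable_cong_sets[OF that refl] .
  show "rel_class C (distr M' borel f) = rel_class C (distr M borel f)"
  proof (subst rel_class_eq_iff[OF C], simp, simp, intro ballI impI)
    fix E assume E: "E \<in> sets borel" "E \<subseteq> - C"
    have "f -` E \<in> sets borel" using measurable_sets[OF f E(1)] by simp
    moreover have "f -` E \<subseteq> - B" using E(2) fB by auto
    ultimately have "emeasure M' (f -` E) = emeasure M (f -` E)"
      using rel_class_mem(3)[OF M'] sets B by (simp add: rel_eq_iff)
    then show "emeasure (distr M' borel f) E = emeasure (distr M borel f) E"
      unfolding emeasure_distr[OF fm[OF sets(1)] E(1)] emeasure_distr[OF fm[OF sets(2)] E(1)]
        sets_eq_imp_space_eq[OF sets(1)] sets_eq_imp_space_eq[OF sets(2)]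
      by simp
  qed
qed

section \<open>The vector space of relative signed measures\<close>

locale pointed_metric_pair =
  fixes A :: "'a::polish_space set"
  assumes closed_A: "closed A" and A_nonempty: "A \<noteq> {}"
begin

abbreviation dA :: "'a \<Rightarrow> ennreal" where
  "dA x \<equiv> ennreal (infdist x A)"

definition fin_moment :: "'a measure set" where
  "fin_moment = {M. sets M = sets borel \<and> (\<integral>\<^sup>+x. dA x \<partial>M) < \<infinity>}"

lemma fin_momentI: "sets M = sets borel \<Longrightarrow> (\<integral>\<^sup>+x. dA x \<partial>M) < \<infinity> \<Longrightarrow> M \<in> fin_moment"
  by (simp add: fin_moment_def)

lemma fin_moment_finite: "M \<in> fin_moment \<Longrightarrow> (\<integral>\<^sup>+x. dA x \<partial>M) < \<infinity>"
  by (simp add: fin_moment_def)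

lemma fin_momentD [simp]: "M \<in> fin_moment \<Longrightarrow> sets M = sets borel"
  by (simp add: fin_moment_def)

lemma space_fin_moment [simp]: "M \<in> fin_moment \<Longrightarrow> space M = UNIV"
  using sets_eq_imp_space_eq[of M borel] by simp

lemma A_borel [measurable]: "A \<in> sets borel"
  using closed_A by auto

lemma infdist_measurable [measurable]: "(\<lambda>x. infdist x A) \<in> borel_measurable borel"
  by (intro borel_measurable_continuous_onI continuous_on_infdist continuous_on_id)

lemma dA_eq_0: "dA x = 0 \<longleftrightarrow> x \<in> A"
  using in_closed_iff_infdist_zero[OF closed_A A_nonempty, of x] infdist_nonneg[of x A]
  by (simp add: ennreal_eq_0_iff antisym_conv)

lemma null_fin [simp]: "null_measure borel \<in> fin_moment"
  by (rule fin_momentI) simp_all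

lemma measurable_sets_borel: "sets M = sets borel \<Longrightarrow> f \<in> borel_measurable borel \<Longrightarrow> f \<in> borel_measurable M"
  by (subst measurable_cong_sets[OF _ refl]) assumption+

lemma sum_fin [simp]: "M \<in> fin_moment \<Longrightarrow> N \<in> fin_moment \<Longrightarrow> sum_measure M N \<in> fin_moment"
  using fin_moment_finite[of M] fin_moment_finite[of N]
  by (intro fin_momentI) (simp_all add: nn_integral_sum_measure measurable_sets_borel)

lemma scale_fin [simp]: "M \<in> fin_moment \<Longrightarrow> scale_measure (ennreal c) M \<in> fin_moment"
  using fin_moment_finite[of M]
  by (intro fin_momentI) (simp_all add: nn_integral_scale_measure measurable_sets_borel ennreal_mult_less_top)

definition wt :: "'a measure \<Rightarrow> 'a set \<Rightarrow> real" where
  "wt M E = measure (density M dA) E"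

lemma emeasure_wt:
  assumes M: "M \<in> fin_moment" and E: "E \<in> sets borel"
  shows "(\<integral>\<^sup>+x. dA x * indicator E x \<partial>M) = ennreal (wt M E)"
proof -
  note [measurable_cong] = fin_momentD[OF M]
  have "emeasure (density M dA) E = (\<integral>\<^sup>+x. dA x * indicator E x \<partial>M)"
    using E M by (intro emeasure_density) auto
  moreover have "(\<integral>\<^sup>+x. dA x * indicator E x \<partial>M) \<le> (\<integral>\<^sup>+x. dA x \<partial>M)"
    by (intro nn_integral_mono) (auto split: split_indicator)
  moreover have "(\<integral>\<^sup>+x. dA x \<partial>M) < \<infinity>" using M by (rule fin_moment_finite)
  ultimately show ?thesis
    by (simp add: wt_def measure_def)
qed

lemma wt_nonneg [simp]: "0 \<le> wt M E"
  by (simp add: wt_def)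

lemma wt_sum:
  assumes M: "M \<in> fin_moment" and N: "N \<in> fin_moment" and E: "E \<in> sets borel"
  shows "wt (sum_measure M N) E = wt M E + wt N E"
proof -
  note [measurable_cong] = fin_momentD[OF M] 
  note [measurable] = E
  have "ennreal (wt (sum_measure M N) E) = ennreal (wt M E + wt N E)"
    using M N E
    by (simp add: emeasure_wt[symmetric] nn_integral_sum_measure[of N M "\<lambda>x. dA x * indicator E x"])
  then show ?thesis by (subst (asm) ennreal_inj) simp_all
qed

lemma wt_scale:
  assumes M: "M \<in> fin_moment" and E: "E \<in> sets borel" and c: "0 \<le> c"
  shows "wt (scale_measure (ennreal c) M) E = c * wt M E"
proof -
  note [measurable_cong] = fin_momentD[OF M]
  note [measurable] = E
  have "ennreal (wt (scale_measure (ennreal c) M) E) = ennreal (c * wt M E)"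
    using M E c
    by (simp add: ennreal_mult emeasure_wt[symmetric] nn_integral_scale_measure[of "\<lambda>x. dA x * indicator E x"])
  then show ?thesis using c by (subst (asm) ennreal_inj) simp_all
qed

lemma wt_null [simp]: "E \<in> sets borel \<Longrightarrow> wt (null_measure borel) E = 0"
  using emeasure_wt[of "null_measure borel" E] by simp

lemma rel_class_eq_iff_wt:
  assumes M: "M \<in> fin_moment" and N: "N \<in> fin_moment"
  shows "rel_class A M = rel_class A N \<longleftrightarrow> (\<forall>E\<in>sets borel. wt M E = wt N E)"
proof
  assume eq: "rel_class A M = rel_class A N"
  show "\<forall>E\<in>sets borel. wt M E = wt N E"
  proof
    fix E assume E[measurable]: "E \<in> sets (borel :: 'a measure)"
    have "(M, N) \<in> rel_eq A"
      using eq rel_class_self[OF closed_A, of N] N by (simp add: rel_class_mem(3))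
    moreover have "(\<lambda>x. dA x * indicator E x) \<in> borel_measurable borel" by measurable
    moreover have "dA x * indicator E x = 0" if "x \<in> A" for x using that by (simp add: dA_eq_0)
    ultimately have "(\<integral>\<^sup>+x. dA x * indicator E x \<partial>M) = (\<integral>\<^sup>+x. dA x * indicator E x \<partial>N)"
      by (rule nn_integral_rel_eq[OF closed_A])
    then show "wt M E = wt N E" using M N E by (simp add: emeasure_wt)
  qed
next
  assume eq: "\<forall>E\<in>sets borel. wt M E = wt N E"
  have dens: "emeasure (density L dA) E = ennreal (wt L E)"
    if "L \<in> fin_moment" "E \<in> sets borel" for L E
  proof -
    note [measurable_cong] = fin_momentD[OF that(1)]
    show ?thesis using that by (subst emeasure_density) (auto simp: emeasure_wt)
  qed
  have "density M dA = density N dA"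
    by (rule measure_eqI) (use M N eq dens in auto)
  moreover have "emeasure L E = (\<integral>\<^sup>+x. inverse (dA x) * indicator E x \<partial>density L dA)"
    if L: "L \<in> fin_moment" and E[measurable]: "E \<in> sets borel" and EA: "E \<subseteq> - A" for L E
  proof -
    note [measurable_cong] = fin_momentD[OF that(1)]
    have "dA x * (inverse (dA x) * indicator E x) = indicator E x" for x
    proof (cases "x \<in> E")
      case True
      then have "0 < infdist x A"
        using EA dA_eq_0[of x] infdist_nonneg[of x A] by (auto simp: less_le)
      then show ?thesis using True by (simp add: inverse_ennreal ennreal_mult[symmetric])
    qed simp
    then have "(\<integral>\<^sup>+x. inverse (dA x) * indicator E x \<partial>density L dA) = (\<integral>\<^sup>+x. indicator E x \<partial>L)"
      by (subst nn_integral_density) auto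
    then show ?thesis using L E by simp
  qed
  ultimately show "rel_class A M = rel_class A N"
    using M N by (simp add: rel_class_eq_iff closed_A)
qed

lemma rel_tight_class:
  assumes M: "M \<in> fin_moment"
  shows "rel_tight A (rel_class A M)"
  unfolding rel_tight_def
proof (intro ballI impI antisym)
  fix E :: "'a set" assume E[measurable]: "E \<in> sets borel" and EA: "E \<subseteq> - A"
  note [measurable_cong] = fin_momentD[OF M]
  have remeasure: "rel_emeasure (rel_class A M) F = emeasure M F" if "F \<in> sets borel" "F \<subseteq> E" for F
    using that EA M by (intro rel_emeasure_class closed_A) auto
  have compact_in: "K \<in> sets borel" if "compact K" for K :: "'a set"
    using compact_imp_closed[OF that] by auto
  define F where "F n = {x\<in>E. 1 / real (Suc n) \<le> infdist x A}" for n
  have F_sets[measurable]: "F n \<in> sets borel" for n unfolding F_def by measurable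
  have FE: "F n \<subseteq> E" for n by (auto simp: F_def)
  have incF: "incseq F"
  proof (unfold incseq_def, intro allI impI subsetI)
    fix m n x assume "m \<le> n" and x: "x \<in> F m"
    then have "1 / real (Suc n) \<le> 1 / real (Suc m)" by (intro frac_le) auto
    then show "x \<in> F n" using x by (simp add: F_def)
  qed
  have UF: "(\<Union>n. F n) = E"
  proof (intro equalityI subsetI)
    fix x assume x: "x \<in> E"
    then have "0 < infdist x A"
      using EA dA_eq_0[of x] infdist_nonneg[of x A] by (auto simp: less_le)
    then obtain n where "1 / real (Suc n) < infdist x A"
      using nat_approx_posE by blast
    then show "x \<in> (\<Union>n. F n)" using x by (auto simp: F_def intro!: exI[of _ n])
  qed (use FE in auto)
  have fin: "emeasure M (F n) < \<infinity>" for n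
  proof -
    have "emeasure M (F n) = (\<integral>\<^sup>+x. indicator (F n) x \<partial>M)" using M by simp
    also have "\<dots> \<le> (\<integral>\<^sup>+x. ennreal (real (Suc n)) * dA x \<partial>M)"
    proof (intro nn_integral_mono)
      fix x
      have "1 \<le> real (Suc n) * infdist x A" if "x \<in> F n"
        using that by (simp add: F_def field_simps)
      then have "1 \<le> ennreal (real (Suc n)) * dA x" if "x \<in> F n"
        using that by (subst ennreal_mult[symmetric]) (simp_all add: infdist_nonneg del: of_nat_Suc)
      then show "indicator (F n) x \<le> ennreal (real (Suc n)) * dA x"
        by (auto split: split_indicator)
    qed
    also have "\<dots> = ennreal (real (Suc n)) * (\<integral>\<^sup>+x. dA x \<partial>M)"
      by (rule nn_integral_cmult) measurable
    also have "\<dots> < \<infinity>" using fin_moment_finite[OF M] by (simp add: ennreal_mult_less_top)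
    finally show ?thesis .
  qed
  let ?S = "SUP K\<in>{K. compact K \<and> K \<subseteq> E}. rel_emeasure (rel_class A M) K"
  have "emeasure M (F n) \<le> ?S" for n
  proof -
    define L where "L = density M (indicator (F n))"
    have L: "emeasure L Y = emeasure M (F n \<inter> Y)" if "Y \<in> sets borel" for Y
      using that M unfolding L_def
      by (subst emeasure_density) (auto simp: indicator_inter_arith[symmetric])
    have "emeasure L (F n) = (SUP K\<in>{K. K \<subseteq> F n \<and> compact K}. emeasure L K)"
    proof (rule inner_regular)
      show "sets L = sets borel" using M by (simp add: L_def)
      have "emeasure L (space L) = emeasure M (F n)"
        using L[of UNIV] M by (simp add: L_def)
      then show "emeasure L (space L) \<noteq> \<infinity>" using fin[of n] by simp
    qed simp
    also have "\<dots> \<le> ?S"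
    proof (rule SUP_least)
      fix K assume "K \<in> {K. K \<subseteq> F n \<and> compact K}"
      then have K: "K \<subseteq> F n" "compact K" by auto
      have "emeasure L K = emeasure M (F n \<inter> K)"
        using compact_in[OF K(2)] by (rule L)
      also have "\<dots> = rel_emeasure (rel_class A M) K"
        using K FE[of n] compact_in[OF K(2)] by (subst remeasure) (auto simp: Int_absorb1)
      also have "\<dots> \<le> ?S" using K FE[of n] by (intro SUP_upper) auto
      finally show "emeasure L K \<le> ?S" .
    qed
    finally show ?thesis using L[OF F_sets[of n]] by simp
  qed
  then have "(SUP n. emeasure M (F n)) \<le> ?S" by (rule SUP_least)
  moreover have "(SUP n. emeasure M (F n)) = emeasure M (\<Union>n. F n)"
    using M incF by (intro SUP_emeasure_incseq) auto
  ultimately show "rel_emeasure (rel_class A M) E \<le> ?S"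
    using remeasure[of E] UF by simp
  show "?S \<le> rel_emeasure (rel_class A M) E"
  proof (rule SUP_least)
    fix K assume "K \<in> {K. compact K \<and> K \<subseteq> E}"
    then have K: "compact K" "K \<subseteq> E" by auto
    then show "rel_emeasure (rel_class A M) K \<le> rel_emeasure (rel_class A M) E"
      using remeasure[of K] remeasure[of E] compact_in[OF K(1)] M by (auto intro: emeasure_mono)
  qed
qed

lemma M1_plus_eq: "M1_plus A = rel_class A ` fin_moment"
proof -
  have "rel_nn_integral (rel_class A M) dA = (\<integral>\<^sup>+x. dA x \<partial>M)" if "sets M = sets borel" for M
    by (rule rel_nn_integral_class[OF closed_A that]) (auto simp: dA_eq_0)
  note int = this
  show ?thesis
  proof (intro equalityI subsetI)
    fix m assume "m \<in> M1_plus A"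
    then obtain M where M: "sets M = sets borel" "m = rel_class A M"
      and "rel_nn_integral (rel_class A M) dA < \<infinity>"
      unfolding M1_plus_def rel_measures_eq by blast
    then have "M \<in> fin_moment" by (intro fin_momentI) (simp_all only: int)
    then show "m \<in> rel_class A ` fin_moment" using M by blast
  next
    fix m assume "m \<in> rel_class A ` fin_moment"
    then obtain M where M: "M \<in> fin_moment" and m: "m = rel_class A M" by blast
    have "m \<in> rel_measures A" using fin_momentD[OF M] m unfolding rel_measures_eq by blast
    then show "m \<in> M1_plus A"
      unfolding M1_plus_def using m rel_tight_class[OF M] int[OF fin_momentD[OF M]] fin_moment_finite[OF M]
      by simp
  qed
qed

definition D :: "'a measure \<Rightarrow> 'a measure \<Rightarrow> ('a measure set \<times> 'a measure set) set" where
  "D M N = formal_diff A (rel_class A M) (rel_class A N)"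

lemma groth_eq_iff:
  assumes "M \<in> fin_moment" "N \<in> fin_moment" "M' \<in> fin_moment" "N' \<in> fin_moment"
  shows "((rel_class A M, rel_class A N), (rel_class A M', rel_class A N')) \<in> groth_eq A \<longleftrightarrow>
    (\<forall>E\<in>sets borel. wt M E - wt N E = wt M' E - wt N' E)"
proof -
  have "rel_add A (rel_class A M) (rel_class A N') = rel_add A (rel_class A M') (rel_class A N) \<longleftrightarrow>
     rel_class A (sum_measure M N') = rel_class A (sum_measure M' N)"
    using assms by (simp add: rel_add_class closed_A)
  also have "\<dots> \<longleftrightarrow> (\<forall>E\<in>sets borel. wt M E + wt N' E = wt M' E + wt N E)"
    using assms by (simp add: rel_class_eq_iff_wt wt_sum)
  finally show ?thesis
    using assms by (auto simp: groth_eq_def M1_plus_eq algebra_simps)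
qed

lemma groth_eqE:
  assumes "((m, n), (m', n')) \<in> groth_eq A"
  obtains M N M' N' where "M \<in> fin_moment" "N \<in> fin_moment" "M' \<in> fin_moment" "N' \<in> fin_moment"
    "m = rel_class A M" "n = rel_class A N" "m' = rel_class A M'" "n' = rel_class A N'"
    "\<forall>E\<in>sets borel. wt M E - wt N E = wt M' E - wt N' E"
proof -
  have "m \<in> M1_plus A" "n \<in> M1_plus A" "m' \<in> M1_plus A" "n' \<in> M1_plus A"
    using assms by (auto simp: groth_eq_def)
  then obtain M N M' N' where *: "M \<in> fin_moment" "N \<in> fin_moment" "M' \<in> fin_moment" "N' \<in> fin_moment"
    "m = rel_class A M" "n = rel_class A N" "m' = rel_class A M'" "n' = rel_class A N'"
    unfolding M1_plus_eq by blast
  with assms that show thesis by (simp add: groth_eq_iff)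
qed

lemma mem_D:
  assumes "M \<in> fin_moment" "N \<in> fin_moment"
  shows "(m, n) \<in> D M N \<longleftrightarrow> (\<exists>M'\<in>fin_moment. \<exists>N'\<in>fin_moment. m = rel_class A M' \<and> n = rel_class A N' \<and>
    (\<forall>E\<in>sets borel. wt M E - wt N E = wt M' E - wt N' E))" (is "_ \<longleftrightarrow> ?R")
proof
  assume "(m, n) \<in> D M N"
  then have "((rel_class A M, rel_class A N), (m, n)) \<in> groth_eq A"
    by (simp add: D_def formal_diff_def)
  moreover from this obtain M' N' where "M' \<in> fin_moment" "N' \<in> fin_moment" "m = rel_class A M'" "n = rel_class A N'"
    by (rule groth_eqE)
  ultimately show ?R using assms by (auto simp: groth_eq_iff)
next
  assume ?R
  then show "(m, n) \<in> D M N" using assms by (auto simp: D_def formal_diff_def groth_eq_iff)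
qed

lemma D_self: "M \<in> fin_moment \<Longrightarrow> N \<in> fin_moment \<Longrightarrow> (rel_class A M, rel_class A N) \<in> D M N"
  unfolding mem_D by blast

lemma D_eq_iff:
  assumes M: "M \<in> fin_moment" "N \<in> fin_moment" and M': "M' \<in> fin_moment" "N' \<in> fin_moment"
  shows "D M N = D M' N' \<longleftrightarrow> (\<forall>E\<in>sets borel. wt M E - wt N E = wt M' E - wt N' E)"
proof
  assume "D M N = D M' N'"
  then have "(rel_class A M', rel_class A N') \<in> D M N" using M' by (simp add: D_self)
  then have "((rel_class A M, rel_class A N), (rel_class A M', rel_class A N')) \<in> groth_eq A"
    by (simp add: D_def formal_diff_def)
  then show "\<forall>E\<in>sets borel. wt M E - wt N E = wt M' E - wt N' E"
    using assms by (simp add: groth_eq_iff)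
next
  assume *: "\<forall>E\<in>sets borel. wt M E - wt N E = wt M' E - wt N' E"
  have "(m, n) \<in> D M N \<longleftrightarrow> (m, n) \<in> D M' N'" for m n
    using * by (simp add: mem_D assms)
  then show "D M N = D M' N'" by auto
qed

lemma carrier_M1: "carrier (M1 A) = {D M N |M N. M \<in> fin_moment \<and> N \<in> fin_moment}"
  by (auto simp: M1_def quotient_def M1_plus_eq D_def formal_diff_def)

lemma D_carrier [simp]: "M \<in> fin_moment \<Longrightarrow> N \<in> fin_moment \<Longrightarrow> D M N \<in> carrier (M1 A)"
  by (auto simp: carrier_M1)

lemma M1_E:
  assumes "x \<in> carrier (M1 A)"
  obtains M N where "M \<in> fin_moment" "N \<in> fin_moment" "x = D M N"
  using assms by (auto simp: carrier_M1)

lemma M1_zero: "\<zero>\<^bsub>M1 A\<^esub> = D (null_measure borel) (null_measure borel)"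
  by (simp add: M1_def D_def rel_zero_class)

lemma UN_D:
  assumes "M \<in> fin_moment" "N \<in> fin_moment"
    and "\<And>M' N'. M' \<in> fin_moment \<Longrightarrow> N' \<in> fin_moment \<Longrightarrow>
      \<forall>E\<in>sets borel. wt M E - wt N E = wt M' E - wt N' E \<Longrightarrow>
      F (rel_class A M') (rel_class A N') = Y"
  shows "(\<Union>(m, n)\<in>D M N. F m n) = Y"
proof -
  have "(case p of (m, n) \<Rightarrow> F m n) = Y" if "p \<in> D M N" for p
    using that assms by (cases p) (auto simp: mem_D)
  moreover have "D M N \<noteq> {}" using D_self[OF assms(1,2)] by blast
  ultimately show ?thesis by blast
qed

lemma M1_add:
  assumes "M \<in> fin_moment" "N \<in> fin_moment" "M' \<in> fin_moment" "N' \<in> fin_moment"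
  shows "D M N \<oplus>\<^bsub>M1 A\<^esub> D M' N' = D (sum_measure M M') (sum_measure N N')"
proof -
  have "D M N \<oplus>\<^bsub>M1 A\<^esub> D M' N' =
    (\<Union>(m, n)\<in>D M N. \<Union>(m', n')\<in>D M' N'. formal_diff A (rel_add A m m') (rel_add A n n'))"
    by (simp add: M1_def)
  also have "\<dots> = D (sum_measure M M') (sum_measure N N')"
  proof (rule UN_D[OF assms(1,2)], rule UN_D[OF assms(3,4)])
    fix M1 N1 M2 N2 :: "'a measure"
    assume fin: "M1 \<in> fin_moment" "N1 \<in> fin_moment" "M2 \<in> fin_moment" "N2 \<in> fin_moment"
      and eq: "\<forall>E\<in>sets borel. wt M E - wt N E = wt M1 E - wt N1 E"
        "\<forall>E\<in>sets borel. wt M' E - wt N' E = wt M2 E - wt N2 E"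
    have "formal_diff A (rel_add A (rel_class A M1) (rel_class A M2)) (rel_add A (rel_class A N1) (rel_class A N2))
      = D (sum_measure M1 M2) (sum_measure N1 N2)"
      using fin by (simp add: rel_add_class closed_A D_def)
    also have "\<dots> = D (sum_measure M M') (sum_measure N N')"
      using fin assms eq by (simp add: D_eq_iff wt_sum) (smt (verit))
    finally show "formal_diff A (rel_add A (rel_class A M1) (rel_class A M2)) (rel_add A (rel_class A N1) (rel_class A N2))
      = D (sum_measure M M') (sum_measure N N')" .
  qed
  finally show ?thesis .
qed

lemma M1_smult:
  assumes "M \<in> fin_moment" "N \<in> fin_moment"
  shows "c \<odot>\<^bsub>M1 A\<^esub> D M N =
    (if 0 \<le> c then D (scale_measure (ennreal c) M) (scale_measure (ennreal c) N)
     else D (scale_measure (ennreal (- c)) N) (scale_measure (ennreal (- c)) M))" (is "_ = ?R")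
proof -
  have "c \<odot>\<^bsub>M1 A\<^esub> D M N = (\<Union>(m, n)\<in>D M N.
        if 0 \<le> c then formal_diff A (rel_scale A c m) (rel_scale A c n)
        else formal_diff A (rel_scale A (- c) n) (rel_scale A (- c) m))"
    by (simp add: M1_def)
  also have "\<dots> = ?R"
  proof (rule UN_D[OF assms])
    fix M1 N1
    assume fin: "M1 \<in> fin_moment" "N1 \<in> fin_moment"
      and eq: "\<forall>E\<in>sets borel. wt M E - wt N E = wt M1 E - wt N1 E"
    have "(if 0 \<le> c then formal_diff A (rel_scale A c (rel_class A M1)) (rel_scale A c (rel_class A N1))
        else formal_diff A (rel_scale A (- c) (rel_class A N1)) (rel_scale A (- c) (rel_class A M1)))
      = (if 0 \<le> c then D (scale_measure (ennreal c) M1) (scale_measure (ennreal c) N1)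
     else D (scale_measure (ennreal (- c)) N1) (scale_measure (ennreal (- c)) M1))"
      using fin by (simp add: rel_scale_class closed_A D_def)
    also have "\<dots> = ?R"
      using fin assms eq by (auto simp: D_eq_iff wt_scale right_diff_distrib[symmetric])
    finally show "(if 0 \<le> c then formal_diff A (rel_scale A c (rel_class A M1)) (rel_scale A c (rel_class A N1))
        else formal_diff A (rel_scale A (- c) (rel_class A N1)) (rel_scale A (- c) (rel_class A M1))) = ?R" .
  qed
  finally show ?thesis .
qed

lemma module_M1: "module real_field (M1 A)"
proof (rule moduleI)
  show "cring real_field" by (rule cring_from_type_algebra)
  show "abelian_group (M1 A)"
  proof (rule abelian_groupI)
    fix x y assume "x \<in> carrier (M1 A)" "y \<in> carrier (M1 A)"
    then show "x \<oplus>\<^bsub>M1 A\<^esub> y \<in> carrier (M1 A)" by (elim M1_E) (simp add: M1_add)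
  next
    show "\<zero>\<^bsub>M1 A\<^esub> \<in> carrier (M1 A)" by (simp add: M1_zero)
  next
    fix x y z assume "x \<in> carrier (M1 A)" "y \<in> carrier (M1 A)" "z \<in> carrier (M1 A)"
    then show "x \<oplus>\<^bsub>M1 A\<^esub> y \<oplus>\<^bsub>M1 A\<^esub> z = x \<oplus>\<^bsub>M1 A\<^esub> (y \<oplus>\<^bsub>M1 A\<^esub> z)"
      by (elim M1_E) (simp add: M1_add D_eq_iff wt_sum)
  next
    fix x y assume "x \<in> carrier (M1 A)" "y \<in> carrier (M1 A)"
    then show "x \<oplus>\<^bsub>M1 A\<^esub> y = y \<oplus>\<^bsub>M1 A\<^esub> x"
      by (elim M1_E) (simp add: M1_add D_eq_iff wt_sum)
  next
    fix x assume "x \<in> carrier (M1 A)"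
    then show "\<zero>\<^bsub>M1 A\<^esub> \<oplus>\<^bsub>M1 A\<^esub> x = x"
      by (elim M1_E) (simp add: M1_zero M1_add D_eq_iff wt_sum)
  next
    fix x assume "x \<in> carrier (M1 A)"
    then obtain M N where "M \<in> fin_moment" "N \<in> fin_moment" "x = D M N" by (rule M1_E)
    then show "\<exists>y\<in>carrier (M1 A). y \<oplus>\<^bsub>M1 A\<^esub> x = \<zero>\<^bsub>M1 A\<^esub>"
      by (intro bexI[of _ "D N M"]) (simp_all add: M1_zero M1_add D_eq_iff wt_sum)
  qed
next
  fix a :: real and x assume "x \<in> carrier (M1 A)"
  then show "a \<odot>\<^bsub>M1 A\<^esub> x \<in> carrier (M1 A)" by (elim M1_E) (simp add: M1_smult)
next
  fix a b :: real and x assume "x \<in> carrier (M1 A)"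
  then obtain M N where "M \<in> fin_moment" "N \<in> fin_moment" "x = D M N" by (rule M1_E)
  then show "(a \<oplus>\<^bsub>real_field\<^esub> b) \<odot>\<^bsub>M1 A\<^esub> x = a \<odot>\<^bsub>M1 A\<^esub> x \<oplus>\<^bsub>M1 A\<^esub> b \<odot>\<^bsub>M1 A\<^esub> x"
    by (simp add: ring_of_type_algebra_def M1_smult M1_add D_eq_iff wt_sum wt_scale algebra_simps del: ennreal_plus)
next
  fix a :: real and x y assume "x \<in> carrier (M1 A)" "y \<in> carrier (M1 A)"
  then show "a \<odot>\<^bsub>M1 A\<^esub> (x \<oplus>\<^bsub>M1 A\<^esub> y) = a \<odot>\<^bsub>M1 A\<^esub> x \<oplus>\<^bsub>M1 A\<^esub> a \<odot>\<^bsub>M1 A\<^esub> y"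
    by (elim M1_E) (simp add: M1_smult M1_add D_eq_iff wt_sum wt_scale algebra_simps)
next
  fix a b :: real and x assume "x \<in> carrier (M1 A)"
  then obtain M N where x: "M \<in> fin_moment" "N \<in> fin_moment" "x = D M N" by (rule M1_E)
  have "(a * b) \<odot>\<^bsub>M1 A\<^esub> x = a \<odot>\<^bsub>M1 A\<^esub> (b \<odot>\<^bsub>M1 A\<^esub> x)"
    using x by (simp add: M1_smult D_eq_iff wt_scale algebra_simps mult_nonneg_nonpos mult_nonpos_nonneg
        mult_nonpos_nonpos zero_le_mult_iff del: scale_scale_measure ennreal_0)
  then show "(a \<otimes>\<^bsub>real_field\<^esub> b) \<odot>\<^bsub>M1 A\<^esub> x = a \<odot>\<^bsub>M1 A\<^esub> (b \<odot>\<^bsub>M1 A\<^esub> x)"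
    by (simp add: ring_of_type_algebra_def)
next
  fix x assume "x \<in> carrier (M1 A)"
  then show "\<one>\<^bsub>real_field\<^esub> \<odot>\<^bsub>M1 A\<^esub> x = x"
    by (elim M1_E) (simp add: ring_of_type_algebra_def M1_smult)
qed

end

section \<open>Positive and negative parts\<close>

context pointed_metric_pair
begin

lemma wt_split:
  assumes M: "M \<in> fin_moment" and P: "P \<in> sets borel" and E: "E \<in> sets borel"
  shows "wt M E = wt M (P \<inter> E) + wt M (- P \<inter> E)"
proof -
  note [measurable_cong] = fin_momentD[OF M]
  note [measurable] = P E
  have "ennreal (wt M E) = (\<integral>\<^sup>+x. dA x * indicator (P \<inter> E) x + dA x * indicator (- P \<inter> E) x \<partial>M)"
    using E by (subst emeasure_wt[OF M, symmetric]) (auto intro!: nn_integral_cong split: split_indicator)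
  also have "\<dots> = ennreal (wt M (P \<inter> E)) + ennreal (wt M (- P \<inter> E))"
    using P E M by (subst nn_integral_add) (simp_all add: emeasure_wt)
  also have "\<dots> = ennreal (wt M (P \<inter> E) + wt M (- P \<inter> E))" by simp
  finally show ?thesis by (subst (asm) ennreal_inj) simp_all
qed

lemma wt_mono:
  assumes "M \<in> fin_moment" "E \<in> sets borel" "F \<in> sets borel" "E \<subseteq> F"
  shows "wt M E \<le> wt M F"
  using wt_split[OF assms(1,2,3)] assms(4) by (simp add: Int_absorb2)

definition res :: "'a set \<Rightarrow> 'a measure \<Rightarrow> 'a measure" where
  "res P M = density M (indicator P)"

lemma
  assumes M: "M \<in> fin_moment" and P: "P \<in> sets borel"
  shows res_fin: "res P M \<in> fin_moment"
    and wt_res: "E \<in> sets borel \<Longrightarrow> wt (res P M) E = wt M (P \<inter> E)"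
proof -
  note [measurable_cong] = fin_momentD[OF M]
  note [measurable] = P
  have int: "(\<integral>\<^sup>+x. dA x * indicator E x \<partial>res P M) = (\<integral>\<^sup>+x. dA x * indicator (P \<inter> E) x \<partial>M)"
    if [measurable]: "E \<in> sets borel" for E
    unfolding res_def by (subst nn_integral_density) (auto intro!: nn_integral_cong split: split_indicator)
  show fin: "res P M \<in> fin_moment"
  proof (rule fin_momentI)
    have "(\<integral>\<^sup>+x. dA x \<partial>res P M) = ennreal (wt M P)"
      using int[of UNIV] emeasure_wt[OF M P] by simp
    then show "(\<integral>\<^sup>+x. dA x \<partial>res P M) < \<infinity>" by simp
  qed (simp add: res_def M)
  show "wt (res P M) E = wt M (P \<inter> E)" if E: "E \<in> sets borel"
  proof -
    have "ennreal (wt (res P M) E) = ennreal (wt M (P \<inter> E))"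
      using int[OF E] E P M fin by (simp add: emeasure_wt)
    then show ?thesis by (subst (asm) ennreal_inj) simp_all
  qed
qed

lemma jordan_decomposition:
  assumes M: "M \<in> fin_moment" and N: "N \<in> fin_moment"
  obtains p n P where "p \<in> fin_moment" "n \<in> fin_moment" "P \<in> sets borel"
    "wt p (- P) = 0" "wt n P = 0" "D M N = D p n"
proof -
  define L where "L = sum_measure (density M dA) (density N dA)"
  have sets_L: "sets L = sets borel" using M by (simp add: L_def)
  note [measurable_cong] = fin_momentD[OF M] fin_momentD[OF N] sets_L
  have dens: "emeasure (density K dA) E = ennreal (wt K E)"
    if K: "K \<in> fin_moment" and E: "E \<in> sets borel" for K E
  proof -
    note [measurable_cong] = fin_momentD[OF K]
    show ?thesis using K E by (subst emeasure_density) (auto simp: emeasure_wt)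
  qed
  have L: "emeasure L E = ennreal (wt M E) + ennreal (wt N E)" if "E \<in> sets borel" for E
    using that M N by (simp add: L_def emeasure_sum_measure dens del: ennreal_plus)
  have "finite_measure L"
  proof
    show "emeasure L (space L) \<noteq> \<infinity>"
      using L[of UNIV] sets_eq_imp_space_eq[OF sets_L] by simp
  qed
  then interpret finite_measure L .
  have dens_sets: "sets (density M dA) = sets L" "sets (density N dA) = sets L"
    using M N sets_L by simp_all
  have null: "E \<in> null_sets (density M dA)" "E \<in> null_sets (density N dA)"
    if "E \<in> null_sets L" for E
  proof -
    have E: "E \<in> sets borel" "emeasure L E = 0" using that sets_L null_setsD2 null_setsD1 by blast+
    then have "ennreal (wt M E) = 0" "ennreal (wt N E) = 0" using L by auto
    then show "E \<in> null_sets (density M dA)" "E \<in> null_sets (density N dA)"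
      using E dens[OF M E(1)] dens[OF N E(1)] dens_sets sets_L by (auto intro!: null_setsI)
  qed
  have "absolutely_continuous L (density M dA)" "absolutely_continuous L (density N dA)"
    unfolding absolutely_continuous_def using null by blast+
  then obtain f g where f: "f \<in> borel_measurable L" "density L f = density M dA"
    and g: "g \<in> borel_measurable L" "density L g = density N dA"
    using Radon_Nikodym[OF _ dens_sets(1)] Radon_Nikodym[OF _ dens_sets(2)] by blast
  note [measurable] = f(1) g(1)
  have fE: "(\<integral>\<^sup>+x. f x * indicator E x \<partial>L) = ennreal (wt M E)"
    and gE: "(\<integral>\<^sup>+x. g x * indicator E x \<partial>L) = ennreal (wt N E)" if "E \<in> sets borel" for E
    using that dens[OF M that] dens[OF N that] sets_L
      emeasure_density[OF f(1), of E] emeasure_density[OF g(1), of E] f(2) g(2) by simp_all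
  define h1 where "h1 x = (if g x < f x then f x - g x else 0)" for x
  define h2 where "h2 x = (if f x < g x then g x - f x else 0)" for x
  have h_meas[measurable]: "h1 \<in> borel_measurable L" "h2 \<in> borel_measurable L"
    unfolding h1_def h2_def by measurable
  have "wt M A = 0 \<and> wt N A = 0"
  proof -
    have "(\<integral>\<^sup>+x. dA x * indicator A x \<partial>K) = 0" for K :: "'a measure"
    proof -
      have "dA x * indicator A x = 0" for x by (auto simp: dA_eq_0 split: split_indicator)
      then show ?thesis by (simp only: nn_integral_const mult_zero_left)
    qed
    then show ?thesis using emeasure_wt[OF M A_borel] emeasure_wt[OF N A_borel] by (simp add: ennreal_eq_0_iff antisym)
  qed
  then have "A \<in> null_sets L" using L[OF A_borel] sets_L by (simp add: null_sets_def)
  then have AE_A: "AE x in L. x \<notin> A" by (rule AE_not_in)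
  have one: "dA x * inverse (dA x) = 1" if "x \<notin> A" for x
  proof -
    have "0 < infdist x A" using that dA_eq_0[of x] infdist_nonneg[of x A] by (auto simp: less_le)
    then show ?thesis by (simp add: inverse_ennreal ennreal_mult[symmetric])
  qed
  have part: "density L (\<lambda>x. h x * inverse (dA x)) \<in> fin_moment \<and>
     (\<forall>E\<in>sets borel. ennreal (wt (density L (\<lambda>x. h x * inverse (dA x))) E) = (\<integral>\<^sup>+x. h x * indicator E x \<partial>L))"
    if h[measurable]: "h \<in> borel_measurable L" and fin: "(\<integral>\<^sup>+x. h x \<partial>L) < \<infinity>" for h
  proof -
    let ?K = "density L (\<lambda>x. h x * inverse (dA x))"
    have int: "(\<integral>\<^sup>+x. dA x * indicator E x \<partial>?K) = (\<integral>\<^sup>+x. h x * indicator E x \<partial>L)"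
      if [measurable]: "E \<in> sets borel" for E
    proof -
      have "(\<integral>\<^sup>+x. dA x * indicator E x \<partial>?K) = (\<integral>\<^sup>+x. (h x * inverse (dA x)) * (dA x * indicator E x) \<partial>L)"
        by (rule nn_integral_density) measurable
      also have "\<dots> = (\<integral>\<^sup>+x. h x * indicator E x \<partial>L)"
      proof (rule nn_integral_cong_AE, use AE_A in eventually_elim)
        case (elim x)
        have "h x * inverse (dA x) * (dA x * indicator E x) = h x * (dA x * inverse (dA x)) * indicator E x"
          by (simp only: mult_ac)
        then show ?case using one[OF elim] by simp
      qed
      finally show ?thesis .
    qed
    have K: "?K \<in> fin_moment"
      by (rule fin_momentI) (use int[of UNIV] fin sets_L in simp_all)
    then show ?thesis using int emeasure_wt[OF K] by simp
  qed
  define p where "p = density L (\<lambda>x. h1 x * inverse (dA x))"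
  define n where "n = density L (\<lambda>x. h2 x * inverse (dA x))"
  have fin_h: "(\<integral>\<^sup>+x. h1 x \<partial>L) < \<infinity>" "(\<integral>\<^sup>+x. h2 x \<partial>L) < \<infinity>"
  proof -
    have "(\<integral>\<^sup>+x. h1 x \<partial>L) \<le> (\<integral>\<^sup>+x. f x * indicator UNIV x \<partial>L)"
      by (intro nn_integral_mono) (auto simp: h1_def)
    then show "(\<integral>\<^sup>+x. h1 x \<partial>L) < \<infinity>" using fE[of UNIV] by (simp add: le_less_trans)
    have "(\<integral>\<^sup>+x. h2 x \<partial>L) \<le> (\<integral>\<^sup>+x. g x * indicator UNIV x \<partial>L)"
      by (intro nn_integral_mono) (auto simp: h2_def)
    then show "(\<integral>\<^sup>+x. h2 x \<partial>L) < \<infinity>" using gE[of UNIV] by (simp add: le_less_trans)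
  qed
  have p: "p \<in> fin_moment" "\<And>E. E \<in> sets borel \<Longrightarrow> ennreal (wt p E) = (\<integral>\<^sup>+x. h1 x * indicator E x \<partial>L)"
    and n: "n \<in> fin_moment" "\<And>E. E \<in> sets borel \<Longrightarrow> ennreal (wt n E) = (\<integral>\<^sup>+x. h2 x * indicator E x \<partial>L)"
    using part[OF h_meas(1) fin_h(1)] part[OF h_meas(2) fin_h(2)] unfolding p_def n_def by blast+
  define P where "P = {x. g x < f x}"
  have P: "P \<in> sets borel"
  proof -
    have "{x \<in> space L. g x < f x} \<in> sets L" by measurable
    then show ?thesis using sets_L sets_eq_imp_space_eq[OF sets_L] by (simp add: P_def)
  qed
  have zero: "h1 x * indicator (- P) x = 0" "h2 x * indicator P x = 0" for x
    by (auto simp: h1_def h2_def P_def split: split_indicator)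
  have "ennreal (wt p (- P)) = 0" "ennreal (wt n P) = 0"
    using p(2)[of "- P"] n(2)[OF P] P zero by simp_all
  then have disj: "wt p (- P) = 0" "wt n P = 0"
    by (simp_all add: ennreal_eq_0_iff antisym)
  have hsum: "h1 x + g x = h2 x + f x" for x
    by (cases "f x" "g x" rule: linorder_cases) (auto simp: h1_def h2_def diff_add_cancel_ennreal)
  have "wt M E - wt N E = wt p E - wt n E" if E[measurable]: "E \<in> sets borel" for E
  proof -
    have "ennreal (wt p E) + ennreal (wt N E) = (\<integral>\<^sup>+x. h1 x * indicator E x + g x * indicator E x \<partial>L)"
      using p(2)[OF E] gE[OF E] by (subst nn_integral_add) simp_all
    also have "\<dots> = (\<integral>\<^sup>+x. h2 x * indicator E x + f x * indicator E x \<partial>L)"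
      by (simp add: hsum distrib_right[symmetric])
    also have "\<dots> = ennreal (wt n E) + ennreal (wt M E)"
      using n(2)[OF E] fE[OF E] by (subst nn_integral_add) simp_all
    finally have "ennreal (wt p E + wt N E) = ennreal (wt n E + wt M E)" by simp
    then have "wt p E + wt N E = wt n E + wt M E" by (subst (asm) ennreal_inj) simp_all
    then show ?thesis by simp
  qed
  then have "D M N = D p n" using M N p(1) n(1) by (simp add: D_eq_iff)
  then show thesis using that p(1) n(1) P disj by blast
qed

lemma M1_embed_D: "M1_embed A (rel_class A p) = D p (null_measure borel)"
  by (simp add: M1_embed_def D_def rel_zero_class)

lemma M1_le_iff:
  assumes "M \<in> fin_moment" "N \<in> fin_moment" "M' \<in> fin_moment" "N' \<in> fin_moment"
  shows "le (M1_order A) (D M N) (D M' N') \<longleftrightarrow>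
    (\<exists>q\<in>fin_moment. \<forall>E\<in>sets borel. wt M' E - wt N' E = wt M E - wt N E + wt q E)"
proof -
  have "le (M1_order A) (D M N) (D M' N') \<longleftrightarrow>
    (\<exists>q\<in>fin_moment. D M' N' = D M N \<oplus>\<^bsub>M1 A\<^esub> D q (null_measure borel))"
    by (simp add: M1_order_def M1_plus_eq M1_embed_D)
  also have "\<dots> \<longleftrightarrow> (\<exists>q\<in>fin_moment. \<forall>E\<in>sets borel. wt M' E - wt N' E = wt M E - wt N E + wt q E)"
    using assms by (intro bex_cong) (simp_all add: M1_add D_eq_iff wt_sum algebra_simps)
  finally show ?thesis .
qed

lemma is_parts_iff:
  assumes p: "p \<in> fin_moment" and n: "n \<in> fin_moment"
  shows "is_parts A x (rel_class A p, rel_class A n) \<longleftrightarrow> x = D p n \<and>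
    (\<forall>a\<in>fin_moment. \<forall>b\<in>fin_moment. \<forall>q\<in>fin_moment. \<forall>r\<in>fin_moment.
      (\<forall>E\<in>sets borel. wt p E = wt a E - wt b E + wt q E) \<longrightarrow>
      (\<forall>E\<in>sets borel. wt n E = wt a E - wt b E + wt r E) \<longrightarrow>
      (\<exists>s\<in>fin_moment. \<forall>E\<in>sets borel. wt a E - wt b E + wt s E = 0))" (is "_ \<longleftrightarrow> _ \<and> ?G")
proof -
  let ?z = "null_measure borel" and ?O = "M1_order A"
  let ?S = "{D p ?z, D n ?z}"
  have carr: "carrier ?O = carrier (M1 A)" by (simp add: M1_order_def)
  have S: "?S \<subseteq> carrier ?O" using p n by (simp add: carr)
  have Lower: "D a b \<in> Lower ?O ?S \<longleftrightarrow>
    (\<exists>q\<in>fin_moment. \<forall>E\<in>sets borel. wt p E = wt a E - wt b E + wt q E) \<and>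
    (\<exists>r\<in>fin_moment. \<forall>E\<in>sets borel. wt n E = wt a E - wt b E + wt r E)"
    if "a \<in> fin_moment" "b \<in> fin_moment" for a b
  proof -
    have "D a b \<in> Lower ?O ?S \<longleftrightarrow> le ?O (D a b) (D p ?z) \<and> le ?O (D a b) (D n ?z)"
      using S that by (auto simp: Lower_def carr)
    then show ?thesis using that p n by (simp add: M1_le_iff)
  qed
  have zero: "D ?z ?z \<in> Lower ?O ?S"
    using p n by (subst Lower) auto
  have le0: "le ?O (D a b) (D ?z ?z) \<longleftrightarrow> (\<exists>s\<in>fin_moment. \<forall>E\<in>sets borel. wt a E - wt b E + wt s E = 0)"
    if "a \<in> fin_moment" "b \<in> fin_moment" for a b
  proof -
    have "wt ?z E - wt ?z E = wt a E - wt b E + wt s E \<longleftrightarrow> wt a E - wt b E + wt s E = 0"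
      if "E \<in> sets borel" for E s using that by auto
    then show ?thesis using that by (simp add: M1_le_iff)
  qed
  have sub: "Lower ?O ?S \<subseteq> carrier ?O" by (auto simp: Lower_def)
  have "greatest ?O \<zero>\<^bsub>M1 A\<^esub> (Lower ?O ?S) \<longleftrightarrow> (\<forall>y\<in>Lower ?O ?S. le ?O y (D ?z ?z))"
    using zero sub by (auto simp: greatest_def M1_zero)
  also have "\<dots> \<longleftrightarrow> (\<forall>a\<in>fin_moment. \<forall>b\<in>fin_moment. D a b \<in> Lower ?O ?S \<longrightarrow> le ?O (D a b) (D ?z ?z))"
    using sub unfolding carr by (auto simp: carrier_M1)
  also have "\<dots> \<longleftrightarrow> ?G"
    using Lower le0 by (simp add: Bex_def Ball_def) blast
  finally show ?thesis
    using p n by (simp add: is_parts_def M1_plus_eq M1_embed_D D_def[symmetric])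
qed

lemma is_parts_disjoint:
  assumes p: "p \<in> fin_moment" and n: "n \<in> fin_moment" and P: "P \<in> sets borel"
    and disj: "wt p (- P) = 0" "wt n P = 0"
  shows "is_parts A (D p n) pn \<longleftrightarrow> pn = (rel_class A p, rel_class A n)"
proof -
  have [simp]: "- P \<in> sets borel" "P \<in> sets borel" using P by auto
  have pz: "wt p (- P \<inter> E) = 0" and nz: "wt n (P \<inter> E) = 0" if "E \<in> sets borel" for E
    using wt_mono[OF p, of "- P \<inter> E" "- P"] wt_mono[OF n, of "P \<inter> E" P] that disj
    by (simp_all add: antisym)
  have parts: "is_parts A (D p n) (rel_class A p, rel_class A n)"
    unfolding is_parts_iff[OF p n]
  proof (intro conjI refl ballI impI)
    fix a b q r assume fin: "a \<in> fin_moment" "b \<in> fin_moment" "q \<in> fin_moment" "r \<in> fin_moment"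
      and q: "\<forall>E\<in>sets borel. wt p E = wt a E - wt b E + wt q E"
      and r: "\<forall>E\<in>sets borel. wt n E = wt a E - wt b E + wt r E"
    show "\<exists>s\<in>fin_moment. \<forall>E\<in>sets borel. wt a E - wt b E + wt s E = 0"
    proof (intro bexI ballI)
      fix E :: "'a set" assume E: "E \<in> sets borel"
      have "wt (sum_measure (res P r) (res (- P) q)) E = wt r (P \<inter> E) + wt q (- P \<inter> E)"
        using fin E by (simp add: wt_sum res_fin wt_res)
      moreover have "wt a (P \<inter> E) - wt b (P \<inter> E) + wt r (P \<inter> E) = 0"
        "wt a (- P \<inter> E) - wt b (- P \<inter> E) + wt q (- P \<inter> E) = 0"
        using q r pz[OF E] nz[OF E] E by (metis P sets.Int sets.compl_sets borel_comp)+
      ultimately show "wt a E - wt b E + wt (sum_measure (res P r) (res (- P) q)) E = 0"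
        using wt_split[OF fin(1) P E] wt_split[OF fin(2) P E] by linarith
    qed (use fin in \<open>simp add: res_fin\<close>)
  qed
  moreover have "pn = (rel_class A p, rel_class A n)" if parts: "is_parts A (D p n) pn"
  proof -
    obtain p' n' where p': "p' \<in> fin_moment" and n': "n' \<in> fin_moment"
      and pn: "pn = (rel_class A p', rel_class A n')"
      using parts by (cases pn) (auto simp: is_parts_def M1_plus_eq)
    note * = parts[unfolded pn is_parts_iff[OF p' n']]
    have eq: "wt p E - wt n E = wt p' E - wt n' E" if "E \<in> sets borel" for E
      using * that p n p' n' by (simp add: D_eq_iff)
    have eqP: "wt p' (P \<inter> E) = wt n' (P \<inter> E) + wt p (P \<inter> E)"
      "wt n' (- P \<inter> E) = wt p' (- P \<inter> E) + wt n (- P \<inter> E)" if "E \<in> sets borel" for E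
      using eq[of "P \<inter> E"] eq[of "- P \<inter> E"] pz[OF that] nz[OF that] that by (simp_all add: sets.Int)
    let ?a = "sum_measure (res (- P) p') (res P n')"
    have a: "?a \<in> fin_moment" using p' n' by (simp add: res_fin)
    have wa: "wt ?a E = wt p' (- P \<inter> E) + wt n' (P \<inter> E)" if "E \<in> sets borel" for E
      using p' n' that by (simp add: wt_sum res_fin wt_res)
    have "\<exists>s\<in>fin_moment. \<forall>E\<in>sets borel. wt ?a E - wt (null_measure borel) E + wt s E = 0"
    proof (rule *[THEN conjunct2, rule_format, OF a null_fin res_fin[OF p P] res_fin[OF n, of "- P"]])
      fix E :: "'a set" assume E: "E \<in> sets borel"
      show "wt p' E = wt ?a E - wt (null_measure borel) E + wt (res P p) E"
        using eqP[OF E] wa[OF E] wt_split[OF p' P E] wt_res[OF p P E] E by simp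
    next
      fix E :: "'a set" assume E: "E \<in> sets borel"
      show "wt n' E = wt ?a E - wt (null_measure borel) E + wt (res (- P) n) E"
        using eqP[OF E] wa[OF E] wt_split[OF n' P E] wt_res[OF n _ E, of "- P"] E by simp
    qed simp
    then have "wt ?a E = 0" if "E \<in> sets borel" for E
      using that wt_nonneg by (smt (verit) wt_null)
    then have z: "wt p' (- P \<inter> E) = 0" "wt n' (P \<inter> E) = 0" if "E \<in> sets borel" for E
      using wa[OF that] that wt_nonneg by (smt (verit))+
    have "wt p' E = wt p E" "wt n' E = wt n E" if E: "E \<in> sets borel" for E
      using eqP[OF E] z[OF E] pz[OF E] nz[OF E] wt_split[OF p' P E] wt_split[OF n' P E]
        wt_split[OF p P E] wt_split[OF n P E] by linarith+
    then show ?thesis using pn p n p' n' by (simp add: rel_class_eq_iff_wt)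
  qed
  ultimately show ?thesis by blast
qed

lemma KR_norm_parts:
  assumes "M \<in> fin_moment" "N \<in> fin_moment"
  obtains p n where "p \<in> fin_moment" "n \<in> fin_moment" "D M N = D p n"
    "KR_norm A (D M N) = W1 A (rel_class A p) (rel_class A n)"
proof -
  obtain p n P where *: "p \<in> fin_moment" "n \<in> fin_moment" "P \<in> sets borel"
    "wt p (- P) = 0" "wt n P = 0" "D M N = D p n"
    using jordan_decomposition[OF assms] by blast
  then have "(THE pn. is_parts A (D M N) pn) = (rel_class A p, rel_class A n)"
    using is_parts_disjoint[OF *(1-5)] by simp
  then show thesis using that * by (simp add: KR_norm_def pos_part_def neg_part_def)
qed

end

section \<open>Transport plans and the Wasserstein distance\<close>

lemma fst_borel [measurable]: "fst \<in> borel_measurable (borel :: ('a::topological_space \<times> 'b::topological_space) measure)"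
  by (intro borel_measurable_continuous_onI continuous_on_fst continuous_on_id)

lemma snd_borel [measurable]: "snd \<in> borel_measurable (borel :: ('a::topological_space \<times> 'b::topological_space) measure)"
  by (intro borel_measurable_continuous_onI continuous_on_snd continuous_on_id)

lemma sum_measure_commute: "sets N = sets M \<Longrightarrow> sum_measure M N = sum_measure N M"
  by (rule measure_eqI) (auto simp: emeasure_sum_measure add.commute)

lemma sum_null_measure: "sets M = sets borel \<Longrightarrow> sum_measure (null_measure borel) M = M"
  by (rule measure_eqI) (auto simp: emeasure_sum_measure)

context pointed_metric_pair
begin

abbreviation db :: "'a \<times> 'a \<Rightarrow> ennreal" where
  "db p \<equiv> ennreal (dbar A (fst p) (snd p))"

lemma dbar_nonneg [simp]: "0 \<le> dbar A x y"
  by (simp add: dbar_def infdist_nonneg)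

lemma dbar_refl [simp]: "dbar A x x = 0"
  by (simp add: dbar_def infdist_nonneg)

lemma dbar_commute: "dbar A x y = dbar A y x"
  by (simp add: dbar_def dist_commute add.commute)

lemma dbar_triangle: "dbar A x z \<le> dbar A x y + dbar A y z"
proof -
  have "dist x z \<le> dist x y + dist y z" by (rule dist_triangle)
  moreover have "infdist x A \<le> infdist y A + dist x y" "infdist z A \<le> infdist y A + dist y z"
    using infdist_triangle[of x A y] infdist_triangle[of z A y] by (simp_all add: dist_commute)
  ultimately show ?thesis
    using infdist_nonneg[of y A] unfolding dbar_def min_def by (smt (verit))
qed

lemma db_zero: "p \<in> A \<times> A \<Longrightarrow> db p = 0"
  by (auto simp: dbar_def)

lemma db_measurable [measurable]: "(\<lambda>p. dbar A (fst p) (snd p)) \<in> borel_measurable borel"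
  unfolding dbar_def
  by (intro borel_measurable_continuous_onI continuous_intros)

lemma space_borel_sets: "sets M = sets borel \<Longrightarrow> space M = UNIV"
  using sets_eq_imp_space_eq[of M borel] by simp

definition plans :: "'a measure \<Rightarrow> 'a measure \<Rightarrow> ('a \<times> 'a) measure set" where
  "plans M N = {\<pi>. sets \<pi> = sets borel \<and> (\<forall>E\<in>sets borel. E \<subseteq> - A \<longrightarrow>
     emeasure \<pi> (E \<times> UNIV) = emeasure M E \<and> emeasure \<pi> (UNIV \<times> E) = emeasure N E)}"

definition cost :: "('a \<times> 'a) measure \<Rightarrow> ennreal" where
  "cost \<pi> = (\<integral>\<^sup>+p. db p \<partial>\<pi>)"

definition W :: "'a measure \<Rightarrow> 'a measure \<Rightarrow> ennreal" where
  "W M N = (INF \<pi>\<in>plans M N. cost \<pi>)"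

lemma plansI:
  assumes "sets \<pi> = sets borel"
    and "\<And>E. E \<in> sets borel \<Longrightarrow> E \<inter> A = {} \<Longrightarrow> emeasure \<pi> (E \<times> UNIV) = emeasure M E"
    and "\<And>E. E \<in> sets borel \<Longrightarrow> E \<inter> A = {} \<Longrightarrow> emeasure \<pi> (UNIV \<times> E) = emeasure N E"
  shows "\<pi> \<in> plans M N"
  using assms unfolding plans_def by blast

lemma plansD:
  assumes "\<pi> \<in> plans M N"
  shows "sets \<pi> = sets borel"
    and "E \<in> sets borel \<Longrightarrow> E \<inter> A = {} \<Longrightarrow> emeasure \<pi> (E \<times> UNIV) = emeasure M E"
    and "E \<in> sets borel \<Longrightarrow> E \<inter> A = {} \<Longrightarrow> emeasure \<pi> (UNIV \<times> E) = emeasure N E"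
  using assms unfolding plans_def by blast+

lemma closed_AA: "closed (A \<times> A)"
  using closed_A by (intro closed_Times)

lemma emeasure_distr_fst:
  assumes "sets \<pi> = sets borel" "E \<in> sets borel"
  shows "emeasure (distr \<pi> borel fst) E = emeasure \<pi> (E \<times> UNIV)"
proof -
  have "fst \<in> borel_measurable \<pi>" using assms(1) fst_borel by (rule measurable_sets_borel)
  moreover have "fst -` E \<inter> space \<pi> = E \<times> UNIV" using space_borel_sets assms(1)
    by (auto dest: sets_eq_imp_space_eq)
  ultimately show ?thesis using assms(2) by (simp add: emeasure_distr)
qed

lemma emeasure_distr_snd:
  assumes "sets \<pi> = sets borel" "E \<in> sets borel"
  shows "emeasure (distr \<pi> borel snd) E = emeasure \<pi> (UNIV \<times> E)"
proof -
  have "snd \<in> borel_measurable \<pi>" using assms(1) snd_borel by (rule measurable_sets_borel)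
  moreover have "snd -` E \<inter> space \<pi> = UNIV \<times> E" using space_borel_sets assms(1)
    by (auto dest: sets_eq_imp_space_eq)
  ultimately show ?thesis using assms(2) by (simp add: emeasure_distr)
qed

lemma couplings_class:
  assumes M: "sets M = sets borel" and N: "sets N = sets borel"
  shows "couplings A (rel_class A M) (rel_class A N) = rel_class (A \<times> A) ` plans M N"
proof -
  have fst: "rel_distr A fst (rel_class (A \<times> A) \<pi>) = rel_class A M \<longleftrightarrow>
      (\<forall>E\<in>sets borel. E \<subseteq> - A \<longrightarrow> emeasure \<pi> (E \<times> UNIV) = emeasure M E)"
    if "sets \<pi> = sets borel" for \<pi>
  proof -
    have "rel_distr A fst (rel_class (A \<times> A) \<pi>) = rel_class A (distr \<pi> borel fst)"
      by (rule rel_distr_class[OF closed_AA closed_A that fst_borel]) auto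
    then show ?thesis using that M
      by (simp add: rel_class_eq_iff[OF closed_A] emeasure_distr_fst)
  qed
  have snd: "rel_distr A snd (rel_class (A \<times> A) \<pi>) = rel_class A N \<longleftrightarrow>
      (\<forall>E\<in>sets borel. E \<subseteq> - A \<longrightarrow> emeasure \<pi> (UNIV \<times> E) = emeasure N E)"
    if "sets \<pi> = sets borel" for \<pi>
  proof -
    have "rel_distr A snd (rel_class (A \<times> A) \<pi>) = rel_class A (distr \<pi> borel snd)"
      by (rule rel_distr_class[OF closed_AA closed_A that snd_borel]) auto
    then show ?thesis using that N
      by (simp add: rel_class_eq_iff[OF closed_A] emeasure_distr_snd)
  qed
  show ?thesis
  proof (intro equalityI subsetI)
    fix m assume m: "m \<in> couplings A (rel_class A M) (rel_class A N)"
    then obtain \<pi> where \<pi>: "sets \<pi> = sets borel" "m = rel_class (A \<times> A) \<pi>"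
      unfolding couplings_def rel_measures_eq by blast
    then have "\<pi> \<in> plans M N"
      using m fst[OF \<pi>(1)] snd[OF \<pi>(1)] unfolding couplings_def plans_def by blast
    then show "m \<in> rel_class (A \<times> A) ` plans M N" using \<pi>(2) by blast
  next
    fix m assume "m \<in> rel_class (A \<times> A) ` plans M N"
    then obtain \<pi> where \<pi>: "\<pi> \<in> plans M N" "m = rel_class (A \<times> A) \<pi>" by blast
    have s: "sets \<pi> = sets borel" by (rule plansD(1)[OF \<pi>(1)])
    then have "m \<in> rel_measures (A \<times> A)" using \<pi>(2) unfolding rel_measures_eq by blast
    then show "m \<in> couplings A (rel_class A M) (rel_class A N)"
      using \<pi> fst[OF s] snd[OF s] unfolding couplings_def plans_def by blast
  qed
qed

lemma W1_class:
  assumes "sets M = sets borel" and "sets N = sets borel"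
  shows "W1 A (rel_class A M) (rel_class A N) = W M N"
proof -
  have "rel_nn_integral (rel_class (A \<times> A) \<pi>) (\<lambda>(x, y). ennreal (dbar A x y)) = cost \<pi>"
    if "\<pi> \<in> plans M N" for \<pi>
  proof -
    have "(\<lambda>(x, y). ennreal (dbar A x y)) = db" by auto
    then show ?thesis
      using rel_nn_integral_class[OF closed_AA plansD(1)[OF that], of db] db_zero
      by (simp add: cost_def)
  qed
  then show ?thesis
    using couplings_class[OF assms] by (simp add: W1_def W_def image_image)
qed

lemma W_le_cost: "\<pi> \<in> plans M N \<Longrightarrow> W M N \<le> cost \<pi>"
  unfolding W_def by (rule INF_lower)

lemma W_cong:
  assumes "sets M = sets borel" "sets M' = sets borel" "rel_class A M = rel_class A M'"
    and "sets N = sets borel" "sets N' = sets borel" "rel_class A N = rel_class A N'"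
  shows "W M N = W M' N'"
  using assms by (simp add: W1_class[symmetric])

lemma cost_sum:
  assumes "sets \<pi> = sets borel" "sets \<rho> = sets borel"
  shows "cost (sum_measure \<pi> \<rho>) = cost \<pi> + cost \<rho>"
  unfolding cost_def using assms
  by (intro nn_integral_sum_measure) (auto intro: measurable_sets_borel)

lemma plans_sum:
  assumes "\<pi> \<in> plans M N" "\<rho> \<in> plans M' N'"
    and sets: "sets M = sets borel" "sets N = sets borel" "sets M' = sets borel" "sets N' = sets borel"
  shows "sum_measure \<pi> \<rho> \<in> plans (sum_measure M M') (sum_measure N N')"
proof (rule plansI)
  note p = plansD[OF assms(1)] plansD[OF assms(2)]
  show "sets (sum_measure \<pi> \<rho>) = sets borel" using p(1) by simp
  fix E :: "'a set" assume E: "E \<in> sets borel" "E \<inter> A = {}"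
  show "emeasure (sum_measure \<pi> \<rho>) (E \<times> UNIV) = emeasure (sum_measure M M') E"
    using p(1,4) p(2,5)[OF E] E sets by (simp add: emeasure_sum_measure borel_Times)
  show "emeasure (sum_measure \<pi> \<rho>) (UNIV \<times> E) = emeasure (sum_measure N N') E"
    using p(1,4) p(3,6)[OF E] E sets by (simp add: emeasure_sum_measure borel_Times)
qed

lemma plans_distr:
  assumes M: "sets M = sets borel" and f: "f \<in> borel_measurable borel"
    and "\<And>E. E \<in> sets borel \<Longrightarrow> E \<inter> A = {} \<Longrightarrow> emeasure M {x. fst (f x) \<in> E} = emeasure K E"
    and "\<And>E. E \<in> sets borel \<Longrightarrow> E \<inter> A = {} \<Longrightarrow> emeasure M {x. snd (f x) \<in> E} = emeasure L E"
  shows "distr M borel f \<in> plans K L"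
proof (rule plansI)
  have f': "f \<in> borel_measurable M" using M f by (rule measurable_sets_borel)
  have sp: "space M = UNIV" using sets_eq_imp_space_eq[OF M] by simp
  fix E :: "'a set" assume E: "E \<in> sets borel" "E \<inter> A = {}"
  have "f -` (E \<times> UNIV) = {x. fst (f x) \<in> E}" "f -` (UNIV \<times> E) = {x. snd (f x) \<in> E}"
    by (auto simp: mem_Times_iff)
  then show "emeasure (distr M borel f) (E \<times> UNIV) = emeasure K E"
    "emeasure (distr M borel f) (UNIV \<times> E) = emeasure L E"
    using assms(3,4)[OF E] E f' sp by (simp_all add: emeasure_distr borel_Times)
qed simp

lemma cost_distr:
  assumes M: "sets M = sets borel" and f: "f \<in> borel_measurable borel"
  shows "cost (distr M borel f) = (\<integral>\<^sup>+x. db (f x) \<partial>M)"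
  unfolding cost_def
  using measurable_sets_borel[OF M f] by (subst nn_integral_distr) simp_all

lemma W_bound:
  assumes M: "M \<in> fin_moment" and N: "N \<in> fin_moment"
  shows "W M N \<le> (\<integral>\<^sup>+x. dA x \<partial>M) + (\<integral>\<^sup>+x. dA x \<partial>N)"
proof -
  let ?z = "null_measure borel :: 'a measure"
  obtain a where a: "a \<in> A" using A_nonempty by blast
  have m: "(\<lambda>x. (x, a)) \<in> borel_measurable borel" "(\<lambda>x. (a, x)) \<in> borel_measurable borel"
    by (rule borel_measurable_continuous_onI, rule continuous_on_Pair; rule continuous_on_const continuous_on_id)+
  have p1: "distr M borel (\<lambda>x. (x, a)) \<in> plans M ?z"
    using a by (intro plans_distr m fin_momentD[OF M]) auto
  have p2: "distr N borel (\<lambda>x. (a, x)) \<in> plans ?z N"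
    using a by (intro plans_distr m fin_momentD[OF N]) auto
  have "sum_measure (distr M borel (\<lambda>x. (x, a))) (distr N borel (\<lambda>x. (a, x))) \<in> plans (sum_measure M ?z) (sum_measure ?z N)"
    by (rule plans_sum[OF p1 p2]) (simp_all add: M N)
  moreover have "sum_measure M ?z = M" "sum_measure ?z N = N"
    using M N sum_measure_commute[of ?z M] by (simp_all add: sum_null_measure)
  ultimately have "W M N \<le> cost (distr M borel (\<lambda>x. (x, a))) + cost (distr N borel (\<lambda>x. (a, x)))"
    using W_le_cost cost_sum by fastforce
  also have "\<dots> = (\<integral>\<^sup>+x. db (x, a) \<partial>M) + (\<integral>\<^sup>+x. db (a, x) \<partial>N)"
    using cost_distr[OF fin_momentD[OF M] m(1)] cost_distr[OF fin_momentD[OF N] m(2)] by simp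
  also have "\<dots> \<le> (\<integral>\<^sup>+x. dA x \<partial>M) + (\<integral>\<^sup>+x. dA x \<partial>N)"
    using a by (intro add_mono nn_integral_mono) (auto simp: dbar_def intro!: ennreal_leI)
  finally show ?thesis .
qed

lemma W_finite:
  assumes "M \<in> fin_moment" and "N \<in> fin_moment"
  shows "W M N < \<infinity>"
  using W_bound[OF assms] fin_moment_finite[OF assms(1)] fin_moment_finite[OF assms(2)]
  by (auto intro: le_less_trans)

lemma W_approx:
  assumes "M \<in> fin_moment" and "N \<in> fin_moment" and "0 < e"
  obtains \<pi> where "\<pi> \<in> plans M N" "cost \<pi> \<le> W M N + ennreal e"
proof -
  have "\<exists>\<pi>\<in>plans M N. cost \<pi> < W M N + ennreal e"
    by (rule INF_approx_ennreal[OF assms(3) W_def less_imp_neq[OF W_finite[OF assms(1,2)]]])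
  then show thesis using that by (auto intro: less_imp_le)
qed

lemma W_refl [simp]:
  assumes M: "sets M = sets borel" shows "W M M = 0"
proof -
  have m: "(\<lambda>x. (x, x)) \<in> borel_measurable (borel :: 'a measure)"
    by (intro borel_measurable_continuous_onI continuous_intros)
  have "distr M borel (\<lambda>x. (x, x)) \<in> plans M M"
    by (intro plans_distr m M) auto
  then have "W M M \<le> cost (distr M borel (\<lambda>x. (x, x)))" by (rule W_le_cost)
  also have "\<dots> = 0" using cost_distr[OF M m] by simp
  finally show ?thesis by simp
qed

lemma W_commute_le: "W N M \<le> W M N"
  unfolding W_def[of M N]
proof (rule INF_greatest)
  fix \<pi> assume \<pi>: "\<pi> \<in> plans M N"
  let ?f = "\<lambda>p::'a \<times> 'a. (snd p, fst p)"
  have m: "?f \<in> borel_measurable borel"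
    by (intro borel_measurable_continuous_onI continuous_intros)
  have m': "?f \<in> borel_measurable \<pi>" by (rule measurable_sets_borel[OF plansD(1)[OF \<pi>] m])
  have sp: "space \<pi> = UNIV" using sets_eq_imp_space_eq[OF plansD(1)[OF \<pi>]] by simp
  have "distr \<pi> borel ?f \<in> plans N M"
  proof (rule plansI)
    fix E :: "'a set" assume E: "E \<in> sets borel" "E \<inter> A = {}"
    have "?f -` (E \<times> UNIV) = UNIV \<times> E" "?f -` (UNIV \<times> E) = E \<times> UNIV" by auto
    then show "emeasure (distr \<pi> borel ?f) (E \<times> UNIV) = emeasure N E"
      "emeasure (distr \<pi> borel ?f) (UNIV \<times> E) = emeasure M E"
      using plansD(2,3)[OF \<pi> E] m' sp E by (simp_all add: emeasure_distr borel_Times)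
  qed simp
  then have "W N M \<le> cost (distr \<pi> borel ?f)" by (rule W_le_cost)
  also have "\<dots> = cost \<pi>"
    unfolding cost_def using m' by (subst nn_integral_distr) (simp_all add: dbar_commute)
  finally show "W N M \<le> cost \<pi>" .
qed

lemma W_commute: "W M N = W N M"
  by (intro antisym W_commute_le)

lemma W_subadditive:
  assumes fin: "M \<in> fin_moment" "N \<in> fin_moment" "M' \<in> fin_moment" "N' \<in> fin_moment"
  shows "W (sum_measure M M') (sum_measure N N') \<le> W M N + W M' N'"
proof (rule ennreal_le_epsilon)
  fix e :: real assume "0 < e"
  then have e: "0 < e / 2" by simp
  obtain \<pi> where \<pi>: "\<pi> \<in> plans M N" "cost \<pi> \<le> W M N + ennreal (e / 2)"
    using W_approx[OF fin(1,2) e] .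
  obtain \<rho> where \<rho>: "\<rho> \<in> plans M' N'" "cost \<rho> \<le> W M' N' + ennreal (e / 2)"
    using W_approx[OF fin(3,4) e] .
  have "W (sum_measure M M') (sum_measure N N') \<le> cost (sum_measure \<pi> \<rho>)"
    by (intro W_le_cost plans_sum[OF \<pi>(1) \<rho>(1)] fin_momentD fin)
  also have "\<dots> = cost \<pi> + cost \<rho>"
    by (rule cost_sum[OF plansD(1)[OF \<pi>(1)] plansD(1)[OF \<rho>(1)]])
  also have "\<dots> \<le> (W M N + ennreal (e / 2)) + (W M' N' + ennreal (e / 2))"
    by (rule add_mono[OF \<pi>(2) \<rho>(2)])
  also have "\<dots> = W M N + W M' N' + (ennreal (e / 2) + ennreal (e / 2))"
    by (simp add: add_ac)
  also have "ennreal (e / 2) + ennreal (e / 2) = ennreal e"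
    using e by (subst ennreal_plus[symmetric]) simp_all
  finally show "W (sum_measure M M') (sum_measure N N') \<le> W M N + W M' N' + ennreal e" .
qed

lemma W_scale_le:
  assumes M: "M \<in> fin_moment" "N \<in> fin_moment" and c: "0 < c"
  shows "W (scale_measure (ennreal c) M) (scale_measure (ennreal c) N) \<le> ennreal c * W M N"
proof (rule ennreal_le_epsilon)
  fix e :: real assume e: "0 < e"
  then obtain \<pi> where \<pi>: "\<pi> \<in> plans M N" "cost \<pi> \<le> W M N + ennreal (e / c)"
    using W_approx[OF M, of "e / c"] c by auto
  have "scale_measure (ennreal c) \<pi> \<in> plans (scale_measure (ennreal c) M) (scale_measure (ennreal c) N)"
    using plansD[OF \<pi>(1)] by (intro plansI) simp_all
  then have "W (scale_measure (ennreal c) M) (scale_measure (ennreal c) N) \<le> cost (scale_measure (ennreal c) \<pi>)"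
    by (rule W_le_cost)
  also have "\<dots> = ennreal c * cost \<pi>"
    unfolding cost_def
    by (intro nn_integral_scale_measure measurable_sets_borel[OF plansD(1)[OF \<pi>(1)]]) measurable
  also have "\<dots> \<le> ennreal c * (W M N + ennreal (e / c))"
    by (intro mult_left_mono \<pi>(2)) simp
  also have "\<dots> = ennreal c * W M N + ennreal e"
    using c e by (simp add: distrib_left ennreal_mult[symmetric])
  finally show "W (scale_measure (ennreal c) M) (scale_measure (ennreal c) N) \<le> ennreal c * W M N + ennreal e" .
qed

lemma W_scale:
  assumes M: "M \<in> fin_moment" "N \<in> fin_moment" and c: "0 < c"
  shows "W (scale_measure (ennreal c) M) (scale_measure (ennreal c) N) = ennreal c * W M N"
proof (rule antisym)
  let ?M = "scale_measure (ennreal c) M" and ?N = "scale_measure (ennreal c) N"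
  have "scale_measure (ennreal (1 / c)) ?M = M" "scale_measure (ennreal (1 / c)) ?N = N"
    using c by (simp_all add: ennreal_mult[symmetric])
  then have "W M N \<le> ennreal (1 / c) * W ?M ?N"
    using W_scale_le[of ?M ?N "1 / c"] M c by simp
  then have "ennreal c * W M N \<le> ennreal c * (ennreal (1 / c) * W ?M ?N)"
    by (intro mult_left_mono) simp_all
  also have "\<dots> = W ?M ?N"
    using c by (simp add: mult.assoc[symmetric] ennreal_mult[symmetric])
  finally show "ennreal c * W M N \<le> W ?M ?N" .
qed (rule W_scale_le[OF assms])

end

section \<open>Gluing transport plans\<close>

text \<open>If \<open>R\<close> and \<open>S\<close> give the same finite mass to each cell of two countable partitions, then
  renormalizing their product on pairs of equal cells gives a plan with marginals \<open>R\<close> and \<open>S\<close>.\<close>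

lemma nn_integral_cell_kernel:
  fixes s :: "'b \<Rightarrow> nat" and t :: "'c \<Rightarrow> nat"
  assumes s[measurable]: "s \<in> R \<rightarrow>\<^sub>M count_space UNIV" and t[measurable]: "t \<in> S \<rightarrow>\<^sub>M count_space UNIV"
    and R: "\<And>i. emeasure R (s -` {i} \<inter> space R) = m i"
    and S: "\<And>i. emeasure S (t -` {i} \<inter> space S) = m i"
    and m: "\<And>i. m i < \<infinity>"
    and g: "g \<in> borel_measurable R"
  shows "(\<integral>\<^sup>+x. \<integral>\<^sup>+y. (if s x = t y then inverse (m (s x)) else 0) * g x \<partial>S \<partial>R) = (\<integral>\<^sup>+x. g x \<partial>R)"
proof -
  have "(\<integral>\<^sup>+y. (if s x = t y then inverse (m (s x)) else 0) * g x \<partial>S) = (inverse (m (s x)) * g x) * m (s x)" for x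
  proof -
    have "(\<integral>\<^sup>+y. (if s x = t y then inverse (m (s x)) else 0) * g x \<partial>S)
      = (\<integral>\<^sup>+y. (inverse (m (s x)) * g x) * indicator (t -` {s x} \<inter> space S) y \<partial>S)"
      by (intro nn_integral_cong) (auto split: split_indicator)
    also have "\<dots> = (inverse (m (s x)) * g x) * m (s x)"
      by (subst nn_integral_cmult_indicator) (simp_all add: S)
    finally show ?thesis .
  qed
  then have "(\<integral>\<^sup>+x. \<integral>\<^sup>+y. (if s x = t y then inverse (m (s x)) else 0) * g x \<partial>S \<partial>R)
      = (\<integral>\<^sup>+x. (inverse (m (s x)) * g x) * m (s x) \<partial>R)" by simp
  also have "\<dots> = (\<integral>\<^sup>+x. g x \<partial>R)"
  proof (rule nn_integral_cong_AE)
    have "AE x in R. m i = 0 \<longrightarrow> s x \<noteq> i" for i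
    proof (cases "m i = 0")
      case True
      then have "s -` {i} \<inter> space R \<in> null_sets R" using R[of i] by (intro null_setsI) simp_all
      then show ?thesis by (rule AE_I') auto
    qed simp
    then have "AE x in R. \<forall>i. m i = 0 \<longrightarrow> s x \<noteq> i" by (simp add: AE_all_countable)
    then show "AE x in R. inverse (m (s x)) * g x * m (s x) = g x"
    proof eventually_elim
      case (elim x)
      then have "m (s x) * inverse (m (s x)) = 1"
        using m[of "s x"] ennreal_divide_self[of "m (s x)"] by (auto simp: divide_ennreal_def)
      then show ?case by (metis mult.assoc mult.commute mult.left_neutral)
    qed
  qed
  finally show ?thesis .
qed

lemma measurable_same_cell:
  fixes u v :: "'b \<Rightarrow> nat" and h :: "nat \<Rightarrow> ennreal"
  assumes u: "u \<in> M \<rightarrow>\<^sub>M count_space UNIV" and v: "v \<in> M \<rightarrow>\<^sub>M count_space UNIV"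
  shows "(\<lambda>z. if u z = v z then h (u z) else 0) \<in> borel_measurable M"
proof -
  have "{z \<in> space M. u z = v z} = (\<Union>i. (u -` {i} \<inter> space M) \<inter> (v -` {i} \<inter> space M))"
    by auto
  moreover have "(\<Union>i. (u -` {i} \<inter> space M) \<inter> (v -` {i} \<inter> space M)) \<in> sets M"
    by (intro sets.countable_UN image_subsetI sets.Int[OF measurable_sets[OF u] measurable_sets[OF v]]) simp_all
  moreover have "(\<lambda>z. h (u z)) \<in> borel_measurable M"
    by (rule measurable_compose[OF u]) simp
  ultimately show ?thesis by (intro measurable_If) simp_all
qed

lemma sigma_finite_measure_cells:
  fixes s :: "'b \<Rightarrow> nat"
  assumes s[measurable]: "s \<in> R \<rightarrow>\<^sub>M count_space UNIV"
    and fin: "\<And>i. emeasure R (s -` {i} \<inter> space R) < \<infinity>"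
  shows "sigma_finite_measure R"
proof
  show "\<exists>F. countable F \<and> F \<subseteq> sets R \<and> \<Union>F = space R \<and> (\<forall>a\<in>F. emeasure R a \<noteq> \<infinity>)"
  proof (intro exI[of _ "range (\<lambda>i. s -` {i} \<inter> space R)"] conjI)
    show "\<Union>(range (\<lambda>i. s -` {i} \<inter> space R)) = space R" by auto
  qed (use fin in \<open>auto simp: less_top\<close>)
qed

context pointed_metric_pair
begin

lemma small_cells:
  assumes N: "N \<in> fin_moment" and \<epsilon>: "0 < \<epsilon>"
  shows "\<exists>s :: 'a \<Rightarrow> nat. s \<in> borel \<rightarrow>\<^sub>M count_space UNIV \<and> (\<forall>y. s y = 0 \<longleftrightarrow> y \<in> A) \<and>
    (\<forall>y y'. s y = s y' \<longrightarrow> dbar A y y' \<le> \<epsilon> * infdist y A) \<and>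
    (\<forall>i. i \<noteq> 0 \<longrightarrow> emeasure N (s -` {i}) < \<infinity>)"
proof -
  define \<delta> where "\<delta> = min (1 / 2) (\<epsilon> / 4)"
  have \<delta>: "0 < \<delta>" "\<delta> \<le> 1 / 2" "4 * \<delta> \<le> \<epsilon>" using \<epsilon> by (auto simp: \<delta>_def)
  obtain Q :: "'a set" where Q: "countable Q" "\<And>U. open U \<Longrightarrow> U \<noteq> {} \<Longrightarrow> \<exists>d\<in>Q. d \<in> U"
    using countable_dense_setE by blast
  have "Q \<noteq> {}" using Q(2)[of UNIV] by auto
  define q where "q = from_nat_into Q"
  define c where "c y = (LEAST i. dist y (q i) < \<delta> * infdist y A)" for y
  define s where "s y = (if y \<in> A then 0 else Suc (c y))" for y
  have pos: "0 < infdist y A" if "y \<notin> A" for y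
    using that dA_eq_0[of y] infdist_nonneg[of y A] by (auto simp: less_le)
  have near: "dist y (q (c y)) < \<delta> * infdist y A" if "y \<notin> A" for y
  proof -
    have "0 < \<delta> * infdist y A" using pos[OF that] \<delta> by simp
    then obtain d where "d \<in> Q" "d \<in> ball y (\<delta> * infdist y A)"
      using Q(2)[of "ball y (\<delta> * infdist y A)"] by auto
    moreover obtain i where "q i = d"
      using \<open>d \<in> Q\<close> Q(1) unfolding q_def by (metis from_nat_into_surj)
    ultimately have "dist y (q i) < \<delta> * infdist y A" by auto
    then show ?thesis unfolding c_def by (rule LeastI)
  qed
  have close: "dist y y' \<le> 4 * \<delta> * infdist y A \<and> infdist y A \<le> 3 * infdist y' A"
    if "y \<notin> A" "y' \<notin> A" "c y = c y'" for y y'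
  proof -
    have "dist y y' \<le> dist y (q (c y)) + dist y' (q (c y'))"
      using that dist_triangle2 by metis
    then have d: "dist y y' \<le> \<delta> * infdist y A + \<delta> * infdist y' A"
      using near[OF that(1)] near[OF that(2)] by linarith
    have h: "\<delta> * infdist y A \<le> infdist y A / 2" "\<delta> * infdist y' A \<le> infdist y' A / 2"
      using mult_right_mono[OF \<delta>(2) infdist_nonneg, of y A] mult_right_mono[OF \<delta>(2) infdist_nonneg, of y' A]
      by simp_all
    have "infdist y A \<le> infdist y' A + dist y y'" "infdist y' A \<le> infdist y A + dist y y'"
      using infdist_triangle[of y A y'] infdist_triangle[of y' A y] by (simp_all add: dist_commute)
    then have "infdist y A \<le> 3 * infdist y' A" and *: "infdist y' A \<le> 3 * infdist y A"
      using d h by linarith+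
    moreover have "\<delta> * infdist y' A \<le> \<delta> * (3 * infdist y A)"
      using * \<delta> by (intro mult_left_mono) auto
    ultimately show ?thesis using d by simp
  qed
  show ?thesis
  proof (intro exI[of _ s] conjI allI impI)
    have [measurable]: "c \<in> borel \<rightarrow>\<^sub>M count_space UNIV" unfolding c_def by measurable
    show s_meas: "s \<in> borel \<rightarrow>\<^sub>M count_space UNIV" unfolding s_def by measurable
    show "s y = 0 \<longleftrightarrow> y \<in> A" for y by (simp add: s_def)
    show "dbar A y y' \<le> \<epsilon> * infdist y A" if "s y = s y'" for y y'
    proof (cases "y \<in> A")
      case True
      then have "y' \<in> A" using that by (simp add: s_def split: if_splits)
      then show ?thesis using True by (simp add: dbar_def)
    next
      case False
      then have y': "y' \<notin> A" "c y = c y'" using that by (auto simp: s_def split: if_splits)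
      have "dbar A y y' \<le> dist y y'" by (simp add: dbar_def)
      also have "\<dots> \<le> 4 * \<delta> * infdist y A" using close[OF False y'] by simp
      also have "\<dots> \<le> \<epsilon> * infdist y A" using \<delta>(3) by (intro mult_right_mono) (simp_all add: infdist_nonneg)
      finally show ?thesis .
    qed
    show "emeasure N (s -` {i}) < \<infinity>" if "i \<noteq> 0" for i
    proof (cases "s -` {i} = {}")
      case False
      then obtain y where y: "s y = i" by auto
      then have yA: "y \<notin> A" using that by (auto simp: s_def)
      note [measurable_cong] = fin_momentD[OF N]
      have "s -` {i} \<in> sets borel"
        using measurable_sets[OF s_meas, of "{i}"] by simp
      then have [measurable]: "s -` {i} \<in> sets N" using N by simp
      have "emeasure N (s -` {i}) = (\<integral>\<^sup>+x. indicator (s -` {i}) x \<partial>N)" by simp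
      also have "\<dots> \<le> (\<integral>\<^sup>+x. ennreal (3 / infdist y A) * dA x \<partial>N)"
      proof (intro nn_integral_mono)
        fix x
        have "1 \<le> ennreal (3 / infdist y A) * dA x" if x: "s x = i"
        proof -
          have "x \<notin> A" "c y = c x" using x y yA by (auto simp: s_def split: if_splits)
          then have "infdist y A \<le> 3 * infdist x A" using close[OF yA] by blast
          then have "1 \<le> 3 / infdist y A * infdist x A" using pos[OF yA] by (simp add: field_simps)
          then show ?thesis using pos[OF yA] by (simp add: ennreal_mult[symmetric] infdist_nonneg)
        qed
        then show "indicator (s -` {i}) x \<le> ennreal (3 / infdist y A) * dA x"
          by (auto split: split_indicator)
      qed
      also have "\<dots> = ennreal (3 / infdist y A) * (\<integral>\<^sup>+x. dA x \<partial>N)"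
        by (rule nn_integral_cmult) measurable
      also have "\<dots> < \<infinity>" using fin_moment_finite[OF N] by (simp add: ennreal_mult_less_top)
      finally show ?thesis .
    qed simp
  qed
qed

lemma emeasure_restricted:
  assumes "sets M = sets borel" "E \<in> sets borel" "F \<in> sets borel"
  shows "emeasure (density M (indicator F)) E = emeasure M (E \<inter> F)"
proof -
  note [measurable_cong] = assms(1)
  have "E \<inter> F \<in> sets M" using assms by auto
  then show ?thesis using assms
    by (subst emeasure_density) (auto simp: indicator_inter_arith[symmetric] Int_commute)
qed

lemma plans_nn_integral_snd:
  assumes "\<pi> \<in> plans M N" and N: "sets N = sets borel"
    and f: "f \<in> borel_measurable borel" "\<And>x. x \<in> A \<Longrightarrow> f x = 0"
  shows "(\<integral>\<^sup>+p. f (snd p) \<partial>\<pi>) = (\<integral>\<^sup>+x. f x \<partial>N)"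
proof -
  note p = plansD[OF assms(1)]
  have "(distr \<pi> borel snd, N) \<in> rel_eq A"
    using p N by (simp add: rel_eq_iff[OF closed_A] emeasure_distr_snd disjoint_eq_subset_Compl)
  then have "(\<integral>\<^sup>+x. f x \<partial>distr \<pi> borel snd) = (\<integral>\<^sup>+x. f x \<partial>N)"
    by (rule nn_integral_rel_eq[OF closed_A _ f])
  then show ?thesis
    using f(1) measurable_sets_borel[OF p(1) snd_borel] by (subst (asm) nn_integral_distr) simp_all
qed

lemma plans_nn_integral_fst:
  assumes "\<pi> \<in> plans M N" and M: "sets M = sets borel"
    and f: "f \<in> borel_measurable borel" "\<And>x. x \<in> A \<Longrightarrow> f x = 0"
  shows "(\<integral>\<^sup>+p. f (fst p) \<partial>\<pi>) = (\<integral>\<^sup>+x. f x \<partial>M)"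
proof -
  note p = plansD[OF assms(1)]
  have "(distr \<pi> borel fst, M) \<in> rel_eq A"
    using p M by (simp add: rel_eq_iff[OF closed_A] emeasure_distr_fst disjoint_eq_subset_Compl)
  then have "(\<integral>\<^sup>+x. f x \<partial>distr \<pi> borel fst) = (\<integral>\<^sup>+x. f x \<partial>M)"
    by (rule nn_integral_rel_eq[OF closed_A _ f])
  then show ?thesis
    using f(1) measurable_sets_borel[OF p(1) fst_borel] by (subst (asm) nn_integral_distr) simp_all
qed

text \<open>The mass moved from or to \<open>A\<close> is kept as it is; the remaining mass is glued cell by cell.\<close>

lemma glue_plans:
  assumes M: "M \<in> fin_moment" and N: "N \<in> fin_moment" and L: "L \<in> fin_moment"
    and \<pi>: "\<pi> \<in> plans M N" and \<rho>: "\<rho> \<in> plans N L" and \<epsilon>: "0 < \<epsilon>"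
  shows "W M L \<le> cost \<pi> + cost \<rho> + ennreal \<epsilon> * (\<integral>\<^sup>+x. dA x \<partial>N)"
proof -
  obtain s :: "'a \<Rightarrow> nat" where s[measurable]: "s \<in> borel \<rightarrow>\<^sub>M count_space UNIV"
    and s0: "\<And>y. s y = 0 \<longleftrightarrow> y \<in> A"
    and s_close: "\<And>y y'. s y = s y' \<Longrightarrow> dbar A y y' \<le> \<epsilon> * infdist y A"
    and s_fin: "\<And>i. i \<noteq> 0 \<Longrightarrow> emeasure N (s -` {i}) < \<infinity>"
    using small_cells[OF N \<epsilon>] by blast
  note p = plansD[OF \<pi>] and r = plansD[OF \<rho>]
  have [measurable]: "UNIV \<times> - A \<in> sets (borel :: ('a \<times> 'a) measure)" "(- A) \<times> UNIV \<in> sets (borel :: ('a \<times> 'a) measure)"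
    "UNIV \<times> A \<in> sets (borel :: ('a \<times> 'a) measure)" "A \<times> UNIV \<in> sets (borel :: ('a \<times> 'a) measure)"
    by (simp_all add: borel_Times)
  define R where "R = density \<pi> (indicator (UNIV \<times> - A))"
  define S where "S = density \<rho> (indicator ((- A) \<times> UNIV))"
  define R' where "R' = density \<pi> (indicator (UNIV \<times> A))"
  define S' where "S' = density \<rho> (indicator (A \<times> UNIV))"
  have sets: "sets R = sets borel" "sets S = sets borel" "sets R' = sets borel" "sets S' = sets borel"
    using p(1) r(1) by (simp_all add: R_def S_def R'_def S'_def)
  note [measurable_cong] = sets p(1) r(1)
  have emeas: "E \<in> sets borel \<Longrightarrow> emeasure R E = emeasure \<pi> (E \<inter> UNIV \<times> - A)"
    "E \<in> sets borel \<Longrightarrow> emeasure S E = emeasure \<rho> (E \<inter> (- A) \<times> UNIV)"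
    "E \<in> sets borel \<Longrightarrow> emeasure R' E = emeasure \<pi> (E \<inter> UNIV \<times> A)"
    "E \<in> sets borel \<Longrightarrow> emeasure S' E = emeasure \<rho> (E \<inter> A \<times> UNIV)" for E
    using p(1) r(1) by (simp_all add: R_def S_def R'_def S'_def emeasure_restricted)
  have split: "(\<integral>\<^sup>+x. f x \<partial>R) + (\<integral>\<^sup>+x. f x \<partial>R') = (\<integral>\<^sup>+x. f x \<partial>\<pi>)"
    "(\<integral>\<^sup>+x. f x \<partial>S) + (\<integral>\<^sup>+x. f x \<partial>S') = (\<integral>\<^sup>+x. f x \<partial>\<rho>)"
    if [measurable]: "f \<in> borel_measurable borel" for f
  proof -
    have "(\<integral>\<^sup>+x. f x \<partial>R) + (\<integral>\<^sup>+x. f x \<partial>R') =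
      (\<integral>\<^sup>+x. indicator (UNIV \<times> - A) x * f x + indicator (UNIV \<times> A) x * f x \<partial>\<pi>)"
      unfolding R_def R'_def by (simp add: nn_integral_density nn_integral_add)
    also have "\<dots> = (\<integral>\<^sup>+x. f x \<partial>\<pi>)"
      by (intro nn_integral_cong) (auto split: split_indicator)
    finally show "(\<integral>\<^sup>+x. f x \<partial>R) + (\<integral>\<^sup>+x. f x \<partial>R') = (\<integral>\<^sup>+x. f x \<partial>\<pi>)" .
    have "(\<integral>\<^sup>+x. f x \<partial>S) + (\<integral>\<^sup>+x. f x \<partial>S') =
      (\<integral>\<^sup>+x. indicator ((- A) \<times> UNIV) x * f x + indicator (A \<times> UNIV) x * f x \<partial>\<rho>)"
      unfolding S_def S'_def by (simp add: nn_integral_density nn_integral_add)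
    also have "\<dots> = (\<integral>\<^sup>+x. f x \<partial>\<rho>)"
      by (intro nn_integral_cong) (auto split: split_indicator)
    finally show "(\<integral>\<^sup>+x. f x \<partial>S) + (\<integral>\<^sup>+x. f x \<partial>S') = (\<integral>\<^sup>+x. f x \<partial>\<rho>)" .
  qed
  have sp: "space R = UNIV" "space S = UNIV" using sets_eq_imp_space_eq[OF sets(1)] sets_eq_imp_space_eq[OF sets(2)] by simp_all
  define m where "m i = (if i = 0 then 0 else emeasure N (s -` {i}))" for i
  have m_fin: "m i < \<infinity>" for i using s_fin by (simp add: m_def)
  have cell: "s -` {i} \<in> sets borel" for i using measurable_sets[OF s, of "{i}"] by simp
  have cells: "emeasure R ((\<lambda>p. s (snd p)) -` {i} \<inter> space R) = m i"
    "emeasure S ((\<lambda>p. s (fst p)) -` {i} \<inter> space S) = m i" for i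
  proof -
    have eq: "(\<lambda>p::'a \<times> 'a. s (snd p)) -` {i} = UNIV \<times> s -` {i}"
      "(\<lambda>p::'a \<times> 'a. s (fst p)) -` {i} = s -` {i} \<times> UNIV"
      by auto
    have *: "(UNIV :: 'a set) \<times> s -` {i} \<inter> UNIV \<times> - A = UNIV \<times> (s -` {i} \<inter> - A)"
      "s -` {i} \<times> (UNIV :: 'a set) \<inter> (- A) \<times> UNIV = (s -` {i} \<inter> - A) \<times> UNIV" by auto
    have "emeasure R ((\<lambda>p. s (snd p)) -` {i} \<inter> space R) = m i \<and>
      emeasure S ((\<lambda>p. s (fst p)) -` {i} \<inter> space S) = m i"
    proof (cases "i = 0")
      case True
      then have "s -` {i} \<inter> - A = {}" "m i = 0" using s0 by (auto simp: m_def)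
      then show ?thesis
        using cell[of i] sp by (simp_all add: eq emeas borel_Times *)
    next
      case False
      then have "s -` {i} \<inter> A = {}" "s -` {i} \<inter> - A = s -` {i}" "m i = emeasure N (s -` {i})"
        by (auto simp: m_def s0[symmetric])
      then show ?thesis
        using cell[of i] sp p(3)[OF cell] r(2)[OF cell] by (simp add: eq emeas borel_Times *)
    qed
    then show "emeasure R ((\<lambda>p. s (snd p)) -` {i} \<inter> space R) = m i"
      "emeasure S ((\<lambda>p. s (fst p)) -` {i} \<inter> space S) = m i" by blast+
  qed
  have sR[measurable]: "(\<lambda>p. s (snd p)) \<in> R \<rightarrow>\<^sub>M count_space UNIV"
    and sS[measurable]: "(\<lambda>p. s (fst p)) \<in> S \<rightarrow>\<^sub>M count_space UNIV" by measurable
  interpret R: sigma_finite_measure R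
    by (rule sigma_finite_measure_cells[OF sR]) (simp only: cells m_fin)
  interpret S: sigma_finite_measure S
    by (rule sigma_finite_measure_cells[OF sS]) (simp only: cells m_fin)
  interpret RS: pair_sigma_finite R S ..
  define k :: "('a \<times> 'a) \<times> ('a \<times> 'a) \<Rightarrow> ennreal" where
    "k z = (if s (snd (fst z)) = s (fst (snd z)) then inverse (m (s (snd (fst z)))) else 0)" for z
  define u where "u z = s (snd (fst z))" for z :: "('a \<times> 'a) \<times> ('a \<times> 'a)"
  define v where "v z = s (fst (snd z))" for z :: "('a \<times> 'a) \<times> ('a \<times> 'a)"
  have fst_RS: "fst \<in> R \<Otimes>\<^sub>M S \<rightarrow>\<^sub>M borel"
    using measurable_fst[of R S] measurable_cong_sets[OF refl sets(1)] by blast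
  have snd_RS: "snd \<in> R \<Otimes>\<^sub>M S \<rightarrow>\<^sub>M borel"
    using measurable_snd[of R S] measurable_cong_sets[OF refl sets(2)] by blast
  have comp_RS: "(\<lambda>z. g (fst z)) \<in> borel_measurable (R \<Otimes>\<^sub>M S)"
    "(\<lambda>z. g (snd z)) \<in> borel_measurable (R \<Otimes>\<^sub>M S)"
    if "g \<in> borel_measurable borel" for g :: "'a \<times> 'a \<Rightarrow> ennreal"
    by (rule measurable_compose[OF fst_RS that] measurable_compose[OF snd_RS that])+
  have uv: "u \<in> R \<Otimes>\<^sub>M S \<rightarrow>\<^sub>M count_space UNIV" "v \<in> R \<Otimes>\<^sub>M S \<rightarrow>\<^sub>M count_space UNIV"
    unfolding u_def[abs_def] v_def[abs_def]
    by (rule measurable_compose[OF measurable_compose[OF fst_RS snd_borel] s]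
          measurable_compose[OF measurable_compose[OF snd_RS fst_borel] s])+
  have "k = (\<lambda>z. if u z = v z then inverse (m (u z)) else 0)"
    by (auto simp: k_def u_def v_def)
  moreover have "(\<lambda>z. if u z = v z then inverse (m (u z)) else 0) \<in> borel_measurable (R \<Otimes>\<^sub>M S)"
    by (rule measurable_same_cell[OF uv, of "\<lambda>i. inverse (m i)"])
  ultimately have k_meas[measurable]: "k \<in> borel_measurable (R \<Otimes>\<^sub>M S)" by (simp only:)
  have int_fst: "(\<integral>\<^sup>+z. k z * g (fst z) \<partial>(R \<Otimes>\<^sub>M S)) = (\<integral>\<^sup>+x. g x \<partial>R)"
    if [measurable]: "g \<in> borel_measurable borel" for g
  proof -
    have "(\<integral>\<^sup>+z. k z * g (fst z) \<partial>(R \<Otimes>\<^sub>M S)) = (\<integral>\<^sup>+x. \<integral>\<^sup>+y. k (x, y) * g (fst (x, y)) \<partial>S \<partial>R)"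
      by (rule S.nn_integral_fst[OF borel_measurable_times_ennreal[OF k_meas comp_RS(1)[OF that]], symmetric])
    also have "\<dots> = (\<integral>\<^sup>+x. g x \<partial>R)"
      unfolding k_def fst_conv snd_conv
      by (rule nn_integral_cell_kernel[OF sR sS cells m_fin measurable_sets_borel[OF sets(1) that]])
    finally show ?thesis .
  qed
  have int_snd: "(\<integral>\<^sup>+z. k z * g (snd z) \<partial>(R \<Otimes>\<^sub>M S)) = (\<integral>\<^sup>+y. g y \<partial>S)"
    if [measurable]: "g \<in> borel_measurable borel" for g
  proof -
    have "(\<integral>\<^sup>+z. k z * g (snd z) \<partial>(R \<Otimes>\<^sub>M S)) = (\<integral>\<^sup>+y. \<integral>\<^sup>+x. k (x, y) * g (snd (x, y)) \<partial>R \<partial>S)"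
      by (rule RS.nn_integral_snd[OF borel_measurable_times_ennreal[OF k_meas comp_RS(2)[OF that]], symmetric])
    also have "\<dots> = (\<integral>\<^sup>+y. \<integral>\<^sup>+x. (if s (fst y) = s (snd x) then inverse (m (s (fst y))) else 0) * g y \<partial>R \<partial>S)"
      by (intro nn_integral_cong) (auto simp: k_def)
    also have "\<dots> = (\<integral>\<^sup>+y. g y \<partial>S)"
      by (rule nn_integral_cell_kernel[OF sS sR cells(2,1) m_fin measurable_sets_borel[OF sets(2) that]])
    finally show ?thesis .
  qed
  have joint0: "(\<lambda>z. (fst (fst z), snd (snd z))) \<in> borel_measurable (R \<Otimes>\<^sub>M S)"
    by (intro borel_measurable_Pair measurable_compose[OF fst_RS fst_borel] measurable_compose[OF snd_RS snd_borel])
  then have joint: "(\<lambda>z. (fst (fst z), snd (snd z))) \<in> borel_measurable (density (R \<Otimes>\<^sub>M S) k)"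
    by simp
  define \<gamma> where "\<gamma> = distr (density (R \<Otimes>\<^sub>M S) k) borel (\<lambda>z. (fst (fst z), snd (snd z)))"
  have \<gamma>: "(\<integral>\<^sup>+p. f p \<partial>\<gamma>) = (\<integral>\<^sup>+z. k z * f (fst (fst z), snd (snd z)) \<partial>(R \<Otimes>\<^sub>M S))"
    if f: "f \<in> borel_measurable borel" for f
    unfolding \<gamma>_def using joint f
    by (subst nn_integral_distr) (simp_all add: nn_integral_density[OF k_meas measurable_compose[OF joint0 f]])
  have \<gamma>_sets: "sets \<gamma> = sets borel" by (simp add: \<gamma>_def)
  let ?\<tau> = "sum_measure \<gamma> (sum_measure R' S')"
  have "?\<tau> \<in> plans M L"
  proof (rule plansI)
    show "sets ?\<tau> = sets borel" using \<gamma>_sets by simp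
    fix E :: "'a set" assume E: "E \<in> sets borel" "E \<inter> A = {}"
    have EE: "E \<times> UNIV \<in> sets (borel :: ('a \<times> 'a) measure)" "UNIV \<times> E \<in> sets (borel :: ('a \<times> 'a) measure)"
      using E by (simp_all add: borel_Times)
    have "emeasure \<gamma> (E \<times> UNIV) = (\<integral>\<^sup>+p. indicator (E \<times> UNIV) p \<partial>\<gamma>)"
      using EE \<gamma>_sets by simp
    also have "\<dots> = (\<integral>\<^sup>+z. k z * indicator (E \<times> UNIV) (fst z) \<partial>(R \<Otimes>\<^sub>M S))"
      using EE by (subst \<gamma>) (auto intro!: nn_integral_cong split: split_indicator)
    also have "\<dots> = emeasure R (E \<times> UNIV)"
      using EE sets by (subst int_fst) simp_all
    finally have "emeasure ?\<tau> (E \<times> UNIV) = emeasure R (E \<times> UNIV) + (emeasure R' (E \<times> UNIV) + emeasure S' (E \<times> UNIV))"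
      using EE \<gamma>_sets sets by (simp add: emeasure_sum_measure)
    also have "emeasure S' (E \<times> UNIV) = 0"
    proof -
      have "E \<times> (UNIV :: 'a set) \<inter> A \<times> UNIV = {}" using E by auto
      then show ?thesis using EE by (simp add: emeas)
    qed
    also have "emeasure R (E \<times> UNIV) + (emeasure R' (E \<times> UNIV) + 0) = emeasure \<pi> (E \<times> UNIV)"
      using split(1)[of "indicator (E \<times> UNIV)"] EE sets p(1) by simp
    finally show "emeasure ?\<tau> (E \<times> UNIV) = emeasure M E" using p(2)[OF E] by simp
    have "emeasure \<gamma> (UNIV \<times> E) = (\<integral>\<^sup>+p. indicator (UNIV \<times> E) p \<partial>\<gamma>)"
      using EE \<gamma>_sets by simp
    also have "\<dots> = (\<integral>\<^sup>+z. k z * indicator (UNIV \<times> E) (snd z) \<partial>(R \<Otimes>\<^sub>M S))"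
      using EE by (subst \<gamma>) (auto intro!: nn_integral_cong split: split_indicator)
    also have "\<dots> = emeasure S (UNIV \<times> E)"
      using EE sets by (subst int_snd) simp_all
    finally have "emeasure ?\<tau> (UNIV \<times> E) = emeasure S (UNIV \<times> E) + (emeasure R' (UNIV \<times> E) + emeasure S' (UNIV \<times> E))"
      using EE \<gamma>_sets sets by (simp add: emeasure_sum_measure)
    also have "emeasure R' (UNIV \<times> E) = 0"
    proof -
      have "(UNIV :: 'a set) \<times> E \<inter> UNIV \<times> A = {}" using E by auto
      then show ?thesis using EE by (simp add: emeas)
    qed
    also have "emeasure S (UNIV \<times> E) + (0 + emeasure S' (UNIV \<times> E)) = emeasure \<rho> (UNIV \<times> E)"
      using split(2)[of "indicator (UNIV \<times> E)"] EE sets r(1) by simp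
    finally show "emeasure ?\<tau> (UNIV \<times> E) = emeasure L E" using r(3)[OF E] by simp
  qed
  then have "W M L \<le> cost ?\<tau>" by (rule W_le_cost)
  also have "\<dots> = cost \<gamma> + (cost R' + cost S')"
    using \<gamma>_sets sets by (simp add: cost_sum)
  also have "cost \<gamma> \<le> (cost R + ennreal \<epsilon> * (\<integral>\<^sup>+x. dA x \<partial>N)) + cost S"
  proof -
    have "cost \<gamma> = (\<integral>\<^sup>+z. k z * db (fst (fst z), snd (snd z)) \<partial>(R \<Otimes>\<^sub>M S))"
      unfolding cost_def by (rule \<gamma>) measurable
    also have "\<dots> \<le> (\<integral>\<^sup>+z. k z * (db (fst z) + ennreal \<epsilon> * dA (snd (fst z))) + k z * db (snd z) \<partial>(R \<Otimes>\<^sub>M S))"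
    proof (rule nn_integral_mono)
      fix z :: "('a \<times> 'a) \<times> ('a \<times> 'a)"
      obtain x y y' w where z: "z = ((x, y), (y', w))" by (metis prod.exhaust)
      show "k z * db (fst (fst z), snd (snd z)) \<le> k z * (db (fst z) + ennreal \<epsilon> * dA (snd (fst z))) + k z * db (snd z)"
      proof (cases "s y = s y'")
        case True
        have "dbar A x w \<le> dbar A x y + dbar A y y' + dbar A y' w"
          using dbar_triangle[of x w y] dbar_triangle[of y w y'] by linarith
        also have "\<dots> \<le> dbar A x y + \<epsilon> * infdist y A + dbar A y' w" using s_close[OF True] by simp
        finally have "ennreal (dbar A x w) \<le> ennreal (dbar A x y + \<epsilon> * infdist y A + dbar A y' w)"
          by (rule ennreal_leI)
        also have "\<dots> = ennreal (dbar A x y) + ennreal \<epsilon> * dA y + ennreal (dbar A y' w)"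
          using \<epsilon> by (simp add: ennreal_mult infdist_nonneg)
        finally show ?thesis
          unfolding z by (simp add: distrib_left[symmetric] mult_left_mono)
      next
        case False
        then show ?thesis by (simp add: k_def z)
      qed
    qed
    also have "\<dots> = (\<integral>\<^sup>+z. k z * (db (fst z) + ennreal \<epsilon> * dA (snd (fst z))) \<partial>(R \<Otimes>\<^sub>M S)) + (\<integral>\<^sup>+z. k z * db (snd z) \<partial>(R \<Otimes>\<^sub>M S))"
      by (rule nn_integral_add[OF
            borel_measurable_times_ennreal[OF k_meas comp_RS(1)[of "\<lambda>p. db p + ennreal \<epsilon> * dA (snd p)"]]
            borel_measurable_times_ennreal[OF k_meas comp_RS(2)[of "\<lambda>p. db p"]]]) measurable
    also have "(\<integral>\<^sup>+z. k z * db (snd z) \<partial>(R \<Otimes>\<^sub>M S)) = cost S"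
      unfolding cost_def by (rule int_snd) measurable
    also have "(\<integral>\<^sup>+z. k z * (db (fst z) + ennreal \<epsilon> * dA (snd (fst z))) \<partial>(R \<Otimes>\<^sub>M S)) = (\<integral>\<^sup>+p. db p + ennreal \<epsilon> * dA (snd p) \<partial>R)"
      by (rule int_fst) measurable
    also have "\<dots> = cost R + (\<integral>\<^sup>+p. ennreal \<epsilon> * dA (snd p) \<partial>R)"
      unfolding cost_def by (rule nn_integral_add) measurable
    also have "(\<integral>\<^sup>+p. ennreal \<epsilon> * dA (snd p) \<partial>R) = ennreal \<epsilon> * (\<integral>\<^sup>+p. dA (snd p) \<partial>R)"
      by (rule nn_integral_cmult) measurable
    also have "(\<integral>\<^sup>+p. dA (snd p) \<partial>R) \<le> (\<integral>\<^sup>+p. dA (snd p) \<partial>\<pi>)"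
    proof -
      have "(\<lambda>p. dA (snd p)) \<in> borel_measurable (borel :: ('a \<times> 'a) measure)" by measurable
      then show ?thesis by (simp add: split(1)[symmetric])
    qed
    also have "(\<integral>\<^sup>+p. dA (snd p) \<partial>\<pi>) = (\<integral>\<^sup>+x. dA x \<partial>N)"
      by (rule plans_nn_integral_snd[OF \<pi> fin_momentD[OF N]]) (auto simp: dA_eq_0)
    finally show ?thesis by (simp add: mult_left_mono add_mono)
  qed
  also have "cost R + ennreal \<epsilon> * (\<integral>\<^sup>+x. dA x \<partial>N) + cost S + (cost R' + cost S')
      = (cost R + cost R') + (cost S + cost S') + ennreal \<epsilon> * (\<integral>\<^sup>+x. dA x \<partial>N)"
    by (simp add: add_ac)
  also have "cost R + cost R' = cost \<pi>" unfolding cost_def by (rule split(1)) measurable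
  also have "cost S + cost S' = cost \<rho>" unfolding cost_def by (rule split(2)) measurable
  finally show ?thesis by (simp add: add_mono)
qed

lemma W_triangle:
  assumes M: "M \<in> fin_moment" and N: "N \<in> fin_moment" and L: "L \<in> fin_moment"
  shows "W M L \<le> W M N + W N L"
proof (rule ennreal_le_epsilon)
  fix e :: real assume e: "0 < e"
  define I where "I = enn2real (\<integral>\<^sup>+x. dA x \<partial>N)"
  have I: "(\<integral>\<^sup>+x. dA x \<partial>N) = ennreal I" using fin_moment_finite[OF N] by (simp add: I_def)
  have I0: "0 \<le> I" by (simp add: I_def)
  obtain \<pi> where \<pi>: "\<pi> \<in> plans M N" "cost \<pi> \<le> W M N + ennreal (e / 3)"
    using W_approx[OF M N, of "e / 3"] e by auto
  obtain \<rho> where \<rho>: "\<rho> \<in> plans N L" "cost \<rho> \<le> W N L + ennreal (e / 3)"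
    using W_approx[OF N L, of "e / 3"] e by auto
  have "W M L \<le> cost \<pi> + cost \<rho> + ennreal (e / 3 / (I + 1)) * ennreal I"
    using glue_plans[OF M N L \<pi>(1) \<rho>(1), of "e / 3 / (I + 1)"] e I0 I by simp
  also have "ennreal (e / 3 / (I + 1)) * ennreal I \<le> ennreal (e / 3)"
  proof -
    have "e / 3 / (I + 1) * I \<le> e / 3" using e I0 by (simp add: field_simps)
    then show ?thesis using e I0 by (simp add: ennreal_mult[symmetric] ennreal_leI)
  qed
  also have "cost \<pi> + cost \<rho> + ennreal (e / 3) \<le> (W M N + ennreal (e / 3)) + (W N L + ennreal (e / 3)) + ennreal (e / 3)"
    by (intro add_mono \<pi>(2) \<rho>(2) order.refl)
  also have "\<dots> = W M N + W N L + (ennreal (e / 3) + ennreal (e / 3) + ennreal (e / 3))"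
    by (simp add: add_ac)
  also have "ennreal (e / 3) + ennreal (e / 3) + ennreal (e / 3) = ennreal e"
    using e by (simp add: ennreal_plus[symmetric] del: ennreal_plus)
  finally show "W M L \<le> W M N + W N L + ennreal e" by (simp add: add_mono)
qed

end

section \<open>Cancellation and definiteness\<close>

context pointed_metric_pair
begin

lemma W_add_le:
  assumes "M \<in> fin_moment" "N \<in> fin_moment" "R \<in> fin_moment"
  shows "W (sum_measure R M) (sum_measure R N) \<le> W M N"
  using W_subadditive[OF assms(3,3,1,2)] assms(3) by simp

text \<open>The summand \<open>R\<close> on the left does not grow with \<open>n\<close>: this yields cancellation, since dividing by
  \<open>n\<close> removes the bounded cost of adding \<open>R\<close> to \<open>n M\<close> and \<open>n N\<close>.\<close>

lemma W_multiple_le: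
  assumes M: "M \<in> fin_moment" and N: "N \<in> fin_moment" and R: "R \<in> fin_moment"
  shows "W (sum_measure (scale_measure (ennreal (real n)) M) R) (sum_measure (scale_measure (ennreal (real n)) N) R)
    \<le> ennreal (real n) * W (sum_measure M R) (sum_measure N R)"
proof (induction n)
  case 0
  have "sum_measure (null_measure M) R = sum_measure (null_measure N) R"
    by (rule measure_eqI) (use M N R in \<open>auto simp: emeasure_sum_measure\<close>)
  then show ?case using N by simp
next
  case (Suc n)
  let ?S = "\<lambda>k L. sum_measure (scale_measure (ennreal (real k)) L) R"
  let ?nM = "scale_measure (ennreal (real n)) M" and ?nN = "scale_measure (ennreal (real n)) N"
  have suc: "?S (Suc n) L = sum_measure L (?S n L)" if "L \<in> fin_moment" for L
    by (rule measure_eqI) (use that R in \<open>auto simp: emeasure_sum_measure ennreal_plus algebra_simps\<close>)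
  have swap: "sum_measure L (?S n N) = sum_measure ?nN (sum_measure L R)" if "L \<in> fin_moment" for L
    by (rule measure_eqI) (use that N R in \<open>auto simp: emeasure_sum_measure algebra_simps\<close>)
  have "W (?S (Suc n) M) (?S (Suc n) N) \<le> W (?S (Suc n) M) (sum_measure M (?S n N)) + W (sum_measure M (?S n N)) (?S (Suc n) N)"
    by (intro W_triangle sum_fin scale_fin M N R)
  also have "W (?S (Suc n) M) (sum_measure M (?S n N)) \<le> W (?S n M) (?S n N)"
    unfolding suc[OF M] by (intro W_add_le sum_fin scale_fin M N R)
  also have "W (sum_measure M (?S n N)) (?S (Suc n) N) \<le> W (sum_measure M R) (sum_measure N R)"
    unfolding suc[OF N] swap[OF M] swap[OF N] by (intro W_add_le sum_fin scale_fin M N R)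
  also have "W (?S n M) (?S n N) \<le> ennreal (real n) * W (sum_measure M R) (sum_measure N R)"
    by (rule Suc.IH)
  also have "ennreal (real n) * W (sum_measure M R) (sum_measure N R) + W (sum_measure M R) (sum_measure N R)
    = ennreal (real (Suc n)) * W (sum_measure M R) (sum_measure N R)"
    by (simp add: distrib_right add.commute)
  finally show ?case by (simp add: add_mono)
qed

lemma W_cancel:
  assumes M: "M \<in> fin_moment" and N: "N \<in> fin_moment" and R: "R \<in> fin_moment"
  shows "W M N \<le> W (sum_measure M R) (sum_measure N R)"
proof -
  let ?z = "null_measure borel :: 'a measure"
  define a where "a = enn2real (W M N)"
  define b where "b = enn2real (W ?z R)"
  define c where "c = enn2real (W (sum_measure M R) (sum_measure N R))"
  have a: "W M N = ennreal a" using W_finite[OF M N] by (simp add: a_def)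
  have b: "W ?z R = ennreal b" using W_finite[OF null_fin R] by (simp add: b_def)
  have c: "W (sum_measure M R) (sum_measure N R) = ennreal c"
    using W_finite[OF sum_fin[OF M R] sum_fin[OF N R]] by (simp add: c_def)
  have pos: "0 \<le> a" "0 \<le> b" "0 \<le> c" by (simp_all add: a_def b_def c_def)
  have *: "real n * a \<le> 2 * b + real n * c" if n: "0 < n" for n :: nat
  proof -
    let ?n = "\<lambda>L. scale_measure (ennreal (real n)) L"
    have half: "W (?n L) (sum_measure (?n L) R) \<le> ennreal b" if L: "L \<in> fin_moment" for L
    proof -
      have "sum_measure (?n L) ?z = ?n L"
        using L sum_measure_commute[of ?z "?n L"] by (simp add: sum_null_measure)
      then show ?thesis using W_add_le[OF null_fin R scale_fin[OF L, of "real n"]] b by simp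
    qed
    have "ennreal (real n * a) = W (?n M) (?n N)"
      using W_scale[OF M N, of "real n"] n pos by (simp add: a ennreal_mult)
    also have "\<dots> \<le> W (?n M) (sum_measure (?n M) R) + W (sum_measure (?n M) R) (?n N)"
      by (intro W_triangle sum_fin scale_fin M N R)
    also have "W (sum_measure (?n M) R) (?n N)
      \<le> W (sum_measure (?n M) R) (sum_measure (?n N) R) + W (sum_measure (?n N) R) (?n N)"
      by (intro W_triangle sum_fin scale_fin M N R)
    also have "W (?n M) (sum_measure (?n M) R) \<le> ennreal b" by (rule half[OF M])
    also have "W (sum_measure (?n N) R) (?n N) \<le> ennreal b"
      using half[OF N] by (simp add: W_commute)
    also have "W (sum_measure (?n M) R) (sum_measure (?n N) R) \<le> ennreal (real n) * ennreal c"
      using W_multiple_le[OF M N R, of n] c by simp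
    also have "ennreal b + (ennreal (real n) * ennreal c + ennreal b) = ennreal (2 * b + real n * c)"
      using pos by (simp add: ennreal_mult[symmetric] ennreal_plus[symmetric] del: ennreal_plus)
    finally have "ennreal (real n * a) \<le> ennreal (2 * b + real n * c)" by (simp only: add_mono)
    then show ?thesis using pos by (subst (asm) ennreal_le_iff) simp_all
  qed
  have "a \<le> c"
  proof (rule ccontr)
    assume "\<not> a \<le> c"
    then obtain n :: nat where n: "2 * b < real n * (a - c)"
      using reals_Archimedean3[of "a - c"] by auto
    then have "0 < n" using pos by (cases n) auto
    then show False using *[of n] n by (simp add: algebra_simps)
  qed
  then show ?thesis by (simp add: a c ennreal_leI)
qed

lemma W_eq_of_D_eq:
  assumes fin: "M \<in> fin_moment" "N \<in> fin_moment" "M' \<in> fin_moment" "N' \<in> fin_moment"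
    and eq: "D M N = D M' N'"
  shows "W M N = W M' N'"
proof -
  have le: "W M N \<le> W M' N'"
    if fin: "M \<in> fin_moment" "N \<in> fin_moment" "M' \<in> fin_moment" "N' \<in> fin_moment" and eq: "D M N = D M' N'"
    for M N M' N'
  proof -
    have "W M N \<le> W (sum_measure M N') (sum_measure N N')"
      by (rule W_cancel[OF fin(1,2,4)])
    also have "\<dots> = W (sum_measure N M') (sum_measure N N')"
    proof (rule W_cong)
      have "wt M E + wt N' E = wt N E + wt M' E" if "E \<in> sets borel" for E
        using eq fin that by (simp add: D_eq_iff algebra_simps)
      then show "rel_class A (sum_measure M N') = rel_class A (sum_measure N M')"
        using fin by (simp add: rel_class_eq_iff_wt wt_sum)
    qed (use fin in simp_all)
    also have "\<dots> \<le> W M' N'" by (rule W_add_le[OF fin(3,4,2)])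
    finally show ?thesis .
  qed
  from le[OF assms] le[OF fin(3,4,1,2) eq[symmetric]] show ?thesis by (rule antisym)
qed

lemma KR_norm_D:
  assumes "M \<in> fin_moment" "N \<in> fin_moment"
  shows "KR_norm A (D M N) = W M N"
proof -
  obtain p n where *: "p \<in> fin_moment" "n \<in> fin_moment" "D M N = D p n"
    "KR_norm A (D M N) = W1 A (rel_class A p) (rel_class A n)"
    by (rule KR_norm_parts[OF assms])
  then show ?thesis using W_eq_of_D_eq[OF assms *(1-3)] by (simp add: W1_class)
qed

lemma lipschitz_integral_le:
  fixes f :: "'a \<Rightarrow> real"
  assumes M: "M \<in> fin_moment" and N: "N \<in> fin_moment" and W0: "W M N = 0"
    and f: "\<And>x. 0 \<le> f x" "\<And>x. x \<in> A \<Longrightarrow> f x = 0" "\<And>x y. f x \<le> f y + C * dist x y"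
    and C: "0 \<le> C" and f_le: "\<And>x. f x \<le> C * infdist x A"
    and f_meas[measurable]: "f \<in> borel_measurable borel"
  shows "(\<integral>\<^sup>+x. ennreal (f x) \<partial>M) \<le> (\<integral>\<^sup>+x. ennreal (f x) \<partial>N)"
proof (rule ennreal_le_epsilon)
  fix e :: real assume e: "0 < e"
  then have e': "0 < e / (C + 1)" using C by simp
  obtain \<pi> where \<pi>: "\<pi> \<in> plans M N" "cost \<pi> \<le> ennreal (e / (C + 1))"
    using W_approx[OF M N e'] W0 by auto
  note [measurable_cong] = plansD(1)[OF \<pi>(1)]
  have zero: "ennreal (f x) = 0" if "x \<in> A" for x using f(2)[OF that] by simp
  have f_meas': "(\<lambda>x. ennreal (f x)) \<in> borel_measurable borel" by measurable
  have "(\<integral>\<^sup>+x. ennreal (f x) \<partial>M) = (\<integral>\<^sup>+p. ennreal (f (fst p)) \<partial>\<pi>)"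
    by (rule plans_nn_integral_fst[OF \<pi>(1) fin_momentD[OF M] f_meas' zero, symmetric])
  also have "\<dots> \<le> (\<integral>\<^sup>+p. ennreal (f (snd p)) + ennreal C * db p \<partial>\<pi>)"
  proof (rule nn_integral_mono)
    fix p :: "'a \<times> 'a"
    have "f (fst p) \<le> f (snd p) + C * (infdist (fst p) A + infdist (snd p) A)"
      using f_le[of "fst p"] f(1)[of "snd p"] mult_nonneg_nonneg[OF C infdist_nonneg[of "snd p" A]]
      by (simp add: algebra_simps)
    then have "f (fst p) \<le> f (snd p) + C * dbar A (fst p) (snd p)"
      using f(3)[of "fst p" "snd p"] by (simp add: dbar_def min_def)
    then have "ennreal (f (fst p)) \<le> ennreal (f (snd p) + C * dbar A (fst p) (snd p))"
      by (rule ennreal_leI)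
    then show "ennreal (f (fst p)) \<le> ennreal (f (snd p)) + ennreal C * db p"
      using f(1) C by (simp add: ennreal_mult)
  qed
  also have "\<dots> = (\<integral>\<^sup>+p. ennreal (f (snd p)) \<partial>\<pi>) + (\<integral>\<^sup>+p. ennreal C * db p \<partial>\<pi>)"
    by (rule nn_integral_add) measurable
  also have "(\<integral>\<^sup>+p. ennreal C * db p \<partial>\<pi>) = ennreal C * cost \<pi>"
    unfolding cost_def by (rule nn_integral_cmult) measurable
  also have "(\<integral>\<^sup>+p. ennreal (f (snd p)) \<partial>\<pi>) = (\<integral>\<^sup>+x. ennreal (f x) \<partial>N)"
    by (rule plans_nn_integral_snd[OF \<pi>(1) fin_momentD[OF N] f_meas' zero])
  also have "ennreal C * cost \<pi> \<le> ennreal C * ennreal (e / (C + 1))"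
    by (intro mult_left_mono \<pi>(2)) simp
  also have "\<dots> \<le> ennreal e"
  proof -
    have "C * (e / (C + 1)) \<le> e" using C e by (simp add: field_simps)
    then show ?thesis using C e by (simp add: ennreal_mult[symmetric] ennreal_leI)
  qed
  finally show "(\<integral>\<^sup>+x. ennreal (f x) \<partial>M) \<le> (\<integral>\<^sup>+x. ennreal (f x) \<partial>N) + ennreal e"
    by (simp add: add_mono)
qed

lemma nn_integral_infdist_open_le:
  assumes M: "M \<in> fin_moment" and N: "N \<in> fin_moment" and W0: "W M N = 0" and V: "open V"
  shows "(\<integral>\<^sup>+x. dA x * indicator V x \<partial>M) \<le> (\<integral>\<^sup>+x. dA x * indicator V x \<partial>N)"
proof (cases "V = UNIV")
  case True
  have "(\<integral>\<^sup>+x. ennreal (infdist x A) \<partial>M) \<le> (\<integral>\<^sup>+x. ennreal (infdist x A) \<partial>N)"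
    by (rule lipschitz_integral_le[OF M N W0, where C=1]) (simp_all add: infdist_nonneg infdist_triangle)
  then show ?thesis using True by simp
next
  case False
  have cl: "closed (- V)" and ne: "- V \<noteq> {}" using V False by auto
  define g where "g n x = min (infdist x A) (real n * infdist x (- V))" for n :: nat and x
  have g0: "0 \<le> g n x" for n x by (simp add: g_def infdist_nonneg)
  have g_meas[measurable]: "g n \<in> borel_measurable borel" for n
    unfolding g_def by (intro borel_measurable_continuous_onI continuous_intros)
  have le: "(\<integral>\<^sup>+x. ennreal (g n x) \<partial>M) \<le> (\<integral>\<^sup>+x. ennreal (g n x) \<partial>N)" for n
  proof (rule lipschitz_integral_le[OF M N W0, where C="max 1 (real n)"])
    show "g n x = 0" if "x \<in> A" for x using that by (simp add: g_def infdist_nonneg)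
    show "g n x \<le> max 1 (real n) * infdist x A" for x
    proof -
      have "g n x \<le> 1 * infdist x A" by (simp add: g_def)
      also have "\<dots> \<le> max 1 (real n) * infdist x A" by (intro mult_right_mono) (simp_all add: infdist_nonneg)
      finally show ?thesis .
    qed
    show "g n x \<le> g n y + max 1 (real n) * dist x y" for x y
    proof -
      have 1: "infdist x A \<le> infdist y A + max 1 (real n) * dist x y"
        using infdist_triangle[of x A y] mult_right_mono[of 1 "max 1 (real n)" "dist x y"] by simp
      have "real n * infdist x (- V) \<le> real n * (infdist y (- V) + dist x y)"
        using infdist_triangle[of x "- V" y] by (intro mult_left_mono) simp_all
      also have "\<dots> \<le> real n * infdist y (- V) + max 1 (real n) * dist x y"
        using mult_right_mono[of "real n" "max 1 (real n)" "dist x y"] by (simp add: distrib_left)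
      finally show ?thesis using 1 unfolding g_def by linarith
    qed
  qed (simp_all add: g0)
  have sup: "(SUP n. ennreal (g n x)) = dA x * indicator V x" for x
  proof (cases "x \<in> V")
    case False
    then have "g n x = 0" for n by (simp add: g_def infdist_nonneg)
    then show ?thesis using False by simp
  next
    case True
    have "0 < infdist x (- V)"
      using in_closed_iff_infdist_zero[OF cl ne, of x] True infdist_nonneg[of x "- V"] by (auto simp: less_le)
    then obtain n :: nat where "infdist x A < real n * infdist x (- V)"
      using reals_Archimedean3 by blast
    then have "g n x = infdist x A" by (simp add: g_def)
    then have "dA x \<le> (SUP n. ennreal (g n x))" by (metis SUP_upper UNIV_I)
    moreover have "(SUP n. ennreal (g n x)) \<le> dA x"
      by (rule SUP_least) (simp add: g_def ennreal_leI)
    ultimately show ?thesis using True by (simp add: antisym)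
  qed
  have mono: "incseq (\<lambda>n x. ennreal (g n x))"
  proof (intro incseq_SucI le_funI ennreal_leI)
    fix n x
    have "real n * infdist x (- V) \<le> real (Suc n) * infdist x (- V)"
      by (intro mult_right_mono) (simp_all add: infdist_nonneg)
    then show "g n x \<le> g (Suc n) x" unfolding g_def by linarith
  qed
  have int: "(\<integral>\<^sup>+x. dA x * indicator V x \<partial>L) = (SUP n. \<integral>\<^sup>+x. ennreal (g n x) \<partial>L)" if "L \<in> fin_moment" for L
  proof -
    note [measurable_cong] = fin_momentD[OF that]
    have "(\<integral>\<^sup>+x. (SUP n. ennreal (g n x)) \<partial>L) = (SUP n. \<integral>\<^sup>+x. ennreal (g n x) \<partial>L)"
      by (rule nn_integral_monotone_convergence_SUP[OF mono]) measurable
    then show ?thesis by (simp add: sup)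
  qed
  show ?thesis unfolding int[OF M] int[OF N] by (intro SUP_mono) (use le in auto)
qed

lemma W_eq_0_imp:
  assumes M: "M \<in> fin_moment" and N: "N \<in> fin_moment" and W0: "W M N = 0"
  shows "rel_class A M = rel_class A N"
proof -
  have dens: "emeasure (density L dA) E = (\<integral>\<^sup>+x. dA x * indicator E x \<partial>L)"
    if "L \<in> fin_moment" "E \<in> sets borel" for L E
  proof -
    note [measurable_cong] = fin_momentD[OF that(1)]
    show ?thesis using that by (subst emeasure_density) auto
  qed
  have W0': "W N M = 0" using W0 by (simp add: W_commute)
  have "density M dA = density N dA"
  proof (rule measure_eqI_generator_eq[where E="{S. open S}" and \<Omega>=UNIV and A="\<lambda>_. UNIV"])
    show "Int_stable {S :: 'a set. open S}" by (auto simp: Int_stable_def)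
    fix V :: "'a set" assume "V \<in> {S. open S}"
    then have "open V" by simp
    then show "emeasure (density M dA) V = emeasure (density N dA) V"
      using nn_integral_infdist_open_le[OF M N W0] nn_integral_infdist_open_le[OF N M W0'] by (simp add: dens M N antisym)
  next
    show "emeasure (density M dA) UNIV \<noteq> \<infinity>"
      using fin_moment_finite[OF M] by (simp add: dens M)
  qed (simp_all add: M N borel_def)
  then show ?thesis using M N by (simp add: rel_class_eq_iff_wt wt_def)
qed

end

theorem proposition1p12:
  fixes A :: "'a::polish_space set"
  assumes "closed A" and "A \<noteq> {}"
    and boundedly_compact: "\<And>S::'a set. closed S \<Longrightarrow> bounded S \<Longrightarrow> compact S"
  shows "(\<forall>x\<in>carrier (M1 A). KR_norm A x < \<infinity>) \<and>
    normed_real_space (M1 A) (\<lambda>x. enn2real (KR_norm A x))"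
proof -
  interpret pointed_metric_pair A by unfold_locales fact+
  have finite: "KR_norm A x < \<infinity>" if "x \<in> carrier (M1 A)" for x
    using that by (elim M1_E) (simp add: KR_norm_D W_finite[unfolded infinity_ennreal_def])
  have "normed_real_space (M1 A) (\<lambda>x. enn2real (KR_norm A x))"
  proof (intro normed_real_space.intro module_M1 normed_real_space_axioms.intro)
    fix x assume x: "x \<in> carrier (M1 A)"
    show "0 \<le> enn2real (KR_norm A x)" by simp
    obtain M N where M: "M \<in> fin_moment" and N: "N \<in> fin_moment" and xD: "x = D M N"
      using x by (rule M1_E)
    have "W M N = 0 \<longleftrightarrow> x = \<zero>\<^bsub>M1 A\<^esub>"
    proof
      assume "W M N = 0"
      then have "rel_class A M = rel_class A N" by (rule W_eq_0_imp[OF M N])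
      then show "x = \<zero>\<^bsub>M1 A\<^esub>" using M N by (simp add: xD M1_zero D_eq_iff rel_class_eq_iff_wt)
    next
      assume "x = \<zero>\<^bsub>M1 A\<^esub>"
      then have "W M N = W (null_measure borel) (null_measure borel)"
        using M N by (intro W_eq_of_D_eq) (simp_all add: xD M1_zero)
      then show "W M N = 0" by simp
    qed
    then show "enn2real (KR_norm A x) = 0 \<longleftrightarrow> x = \<zero>\<^bsub>M1 A\<^esub>"
      using M N W_finite[OF M N] by (auto simp: xD KR_norm_D enn2real_eq_0_iff)
    have scale: "enn2real (W (scale_measure (ennreal c) M) (scale_measure (ennreal c) N)) = c * enn2real (W M N)"
      if "0 \<le> c" for c
    proof (cases "c = 0")
      case True
      have "W (scale_measure (ennreal 0) M) (scale_measure (ennreal 0) N)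
        = W (null_measure borel) (null_measure borel)"
      proof (rule W_eq_of_D_eq)
        show "D (scale_measure (ennreal 0) M) (scale_measure (ennreal 0) N) = D (null_measure borel) (null_measure borel)"
          unfolding D_eq_iff[OF scale_fin[OF M] scale_fin[OF N] null_fin null_fin]
          using wt_scale[OF M _ order.refl] wt_scale[OF N _ order.refl] by simp
      qed (intro scale_fin null_fin M N)+
      then show ?thesis using True by simp
    next
      case False
      then show ?thesis using that W_scale[OF M N, of c] by (simp add: enn2real_mult)
    qed
    show "enn2real (KR_norm A (c \<odot>\<^bsub>M1 A\<^esub> x)) = \<bar>c\<bar> * enn2real (KR_norm A x)" for c
      using M N scale[of c] scale[of "- c"]
        W_commute[of "scale_measure (ennreal (- c)) N" "scale_measure (ennreal (- c)) M"]
      by (simp add: xD M1_smult KR_norm_D del: ennreal_neg)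
  next
    fix x y assume "x \<in> carrier (M1 A)" "y \<in> carrier (M1 A)"
    then obtain M N M' N' where fin: "M \<in> fin_moment" "N \<in> fin_moment" "M' \<in> fin_moment" "N' \<in> fin_moment"
      and xy: "x = D M N" "y = D M' N'"
      by (elim M1_E) blast
    have "enn2real (W (sum_measure M M') (sum_measure N N')) \<le> enn2real (W M N + W M' N')"
      using W_subadditive[OF fin] W_finite[OF fin(1,2)] W_finite[OF fin(3,4)]
      by (intro enn2real_mono) simp_all
    also have "\<dots> = enn2real (W M N) + enn2real (W M' N')"
      using W_finite[OF fin(1,2)] W_finite[OF fin(3,4)] by (intro enn2real_plus) simp_all
    finally show "enn2real (KR_norm A (x \<oplus>\<^bsub>M1 A\<^esub> y)) \<le> enn2real (KR_norm A x) + enn2real (KR_norm A y)"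
      using fin by (simp add: xy M1_add KR_norm_D)
  qed
  with finite show ?thesis by blast
qed

end
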